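(* Let $A\in\mathbb{R}^{n\times n}$, $B\in\mathbb{R}^{n\times p}$, $C\in\mathbb{R}^{m\times n}$, let $R\in\mathbb{R}^{p\times p}$ be symmetric positive definite, and let $\alpha>0$. If $(A,C)$ is observable, then the system $$\dot P=\alpha A^\top P+\alpha PA-\frac{1}{\mathrm{tr}(P)}PBR^{-1}B^\top P+\alpha^2\,\mathrm{tr}(P)\,C^\top C$$ is strictly positive on $\mathbb{S}_+^n$.
   Context: $\mathbb{S}_+^n$ is the cone of real symmetric positive semidefinite $n\times n$ matrices, in the space of real symmetric $n\times n$ matrices; its interior $\mathrm{Int}\,\mathbb{S}_+^n$ is the set of positive definite matrices, and $X\preceq Y$ means $Y-X\in\mathbb{S}_+^n$. The pair $(A,C)$ is observable if the stacked matrix $\mathrm{col}(C,CA,\dots,CA^{n-1})$ has full (column) rank $n$. The right-hand side of the differential equation is taken to be $0$ at $P=0$. A map $T$ with $T(\mathbb{S}_+^n)\subseteq\mathbb{S}_+^n$ is strictly order-preserving (also called strongly order-preserving) if $0\preceq X\preceq Y$ and $X\neq Y$ imply $T(Y)-T(X)\in\mathrm{Int}\,\mathbb{S}_+^n$. Write $\phi(t,P_0)$ for the solution at time $t$ of the differential equation with initial value $P_0\in\mathbb{S}_+^n$ at time $0$. The system is strictly positive on $\mathbb{S}_+^n$ if for every $t>0$ the map $P_0\mapsto\phi(t,P_0)$ maps $\mathbb{S}_+^n$ into itself and is strictly order-preserving. *)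

theory Defs
  imports "HOL-Analysis.Analysis"
begin

section \<open>The cone of positive semidefinite matrices\<close>

definition symmetric_matrices :: "(real^'n^'n) set" where
  "symmetric_matrices = {X. transpose X = X}"

definition psd_cone :: "(real^'n^'n) set" where
  "psd_cone = {X \<in> symmetric_matrices. \<forall>x. 0 \<le> x \<bullet> (X *v x)}"

text \<open>The positive definite matrices are the interior of the cone relative to the space of
  symmetric matrices (in the space of all square matrices the cone has empty interior as soon
  as the size is at least 2).\<close>

definition pd_matrices :: "(real^'n^'n) set" where
  "pd_matrices = {X \<in> symmetric_matrices. \<forall>x. x \<noteq> 0 \<longrightarrow> 0 < x \<bullet> (X *v x)}"

definition loewner_le :: "real^'n^'n \<Rightarrow> real^'n^'n \<Rightarrow> bool" where
  "loewner_le X Y \<longleftrightarrow> Y - X \<in> psd_cone"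

definition strictly_order_preserving :: "(real^'n^'n \<Rightarrow> real^'n^'n) \<Rightarrow> bool" where
  "strictly_order_preserving T \<longleftrightarrow>
     T ` psd_cone \<subseteq> psd_cone \<and>
     (\<forall>X Y. loewner_le 0 X \<and> loewner_le X Y \<and> X \<noteq> Y \<longrightarrow> T Y - T X \<in> pd_matrices)"


section \<open>Observability\<close>

definition matrix_power :: "real^'n^'n \<Rightarrow> nat \<Rightarrow> real^'n^'n" where
  "matrix_power A k = (((**) A) ^^ k) (mat 1)"

text \<open>The stacked matrix with blocks \<open>C A\<^sup>k\<close>, \<open>0 \<le> k < n\<close>. Its rows are indexed by pairs
  \<open>(k, i)\<close>, meaning row \<open>i\<close> of the block with exponent \<open>to_nat_on UNIV k\<close>; the map
  \<open>to_nat_on UNIV\<close> is a bijection from the finite index type onto \<open>{..<n}\<close>.\<close>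

definition observability_matrix ::
    "real^'n^'n \<Rightarrow> real^'n^'m \<Rightarrow> real^'n^('n \<times> 'm)" where
  "observability_matrix A C =
     (\<chi> ki. (C ** matrix_power A (to_nat_on (UNIV :: 'n set) (fst ki))) $ snd ki)"

definition observable :: "real^'n^'n \<Rightarrow> real^'n^'m \<Rightarrow> bool" where
  "observable A C \<longleftrightarrow> rank (observability_matrix A C) = CARD('n)"


section \<open>Autonomous matrix differential equations\<close>

definition solves_ivp ::
    "(real^'n^'n \<Rightarrow> real^'n^'n) \<Rightarrow> (real^'n^'n) set \<Rightarrow> real^'n^'n \<Rightarrow> real \<Rightarrow>
     (real \<Rightarrow> real^'n^'n) \<Rightarrow> bool" where
  "solves_ivp f D P0 t P \<longleftrightarrow>
     P 0 = P0 \<and>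
     (\<forall>s\<in>{0..t}. P s \<in> D \<and> (P has_vector_derivative f (P s)) (at s within {0..t}))"

definition flow_value ::
    "(real^'n^'n \<Rightarrow> real^'n^'n) \<Rightarrow> (real^'n^'n) set \<Rightarrow> real \<Rightarrow> real^'n^'n \<Rightarrow> real^'n^'n \<Rightarrow> bool"
  where
  "flow_value f D t P0 X \<longleftrightarrow> (\<exists>P. solves_ivp f D P0 t P \<and> P t = X)"

definition flow ::
    "(real^'n^'n \<Rightarrow> real^'n^'n) \<Rightarrow> (real^'n^'n) set \<Rightarrow> real \<Rightarrow> real^'n^'n \<Rightarrow> real^'n^'n" where
  "flow f D t P0 = (THE X. flow_value f D t P0 X)"

text \<open>The first conjunct says that \<open>flow f D t\<close> is well defined on the cone: without it the
  description operator could return an arbitrary matrix.\<close>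

definition strictly_positive_system ::
    "(real^'n^'n \<Rightarrow> real^'n^'n) \<Rightarrow> (real^'n^'n) set \<Rightarrow> bool" where
  "strictly_positive_system f D \<longleftrightarrow>
     (\<forall>t>0. (\<forall>P0\<in>psd_cone. \<exists>!X. flow_value f D t P0 X) \<and>
            flow f D t ` psd_cone \<subseteq> psd_cone \<and>
            strictly_order_preserving (flow f D t))"


section \<open>The differential equation\<close>

definition riccati_rhs ::
    "real^'n^'n \<Rightarrow> real^'p^'n \<Rightarrow> real^'n^'m \<Rightarrow> real^'p^'p \<Rightarrow> real \<Rightarrow> real^'n^'n \<Rightarrow> real^'n^'n" where
  "riccati_rhs A B C R \<alpha> P =
     (if P = 0 then 0
      else \<alpha> *\<^sub>R (transpose A ** P) + \<alpha> *\<^sub>R (P ** A)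
           - (1 / trace P) *\<^sub>R (P ** B ** matrix_inv R ** transpose B ** P)
           + (\<alpha>\<^sup>2 * trace P) *\<^sub>R (transpose C ** C))"

text \<open>The symmetric matrices at which the right-hand side makes sense. Solutions are required
  to stay here, so that division by zero plays no role; that they stay in the positive
  semidefinite cone is not presupposed.\<close>

definition riccati_domain :: "(real^'n^'n) set" where
  "riccati_domain = {P \<in> symmetric_matrices. P = 0 \<or> trace P \<noteq> 0}"

end

theory Submission
  imports Defs
begin

text \<open>Write \<open>M = B R\<^sup>-\<^sup>1 B\<^sup>T\<close>. For two solutions \<open>P, Q\<close> with positive trace put \<open>D = Q - P\<close> and
  \<open>U = Q / tr Q\<close>. Since \<open>P M P / tr P\<close> is a matrix-convex, homogeneous function of \<open>P\<close>, one has
  \<open>D' = L\<^sup>T D + D L + tr D (\<alpha>\<^sup>2 C\<^sup>T C + U M U) + W\<close> with \<open>L = \<alpha> A - M U\<close> and \<open>W\<close> positive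
  semidefinite, and the same with \<open>P = 0\<close>, \<open>D = Q\<close>. Such an equation preserves the cone and keeps
  \<open>tr D\<close> positive; if \<open>x\<close> is in the kernel of \<open>D\<close> at a positive time, then
  \<open>C exp (\<alpha> s A) x = 0\<close> on an interval, so \<open>x = 0\<close> by observability. Here \<open>L\<close> is bounded because
  \<open>\<parallel>P\<parallel> \<le> tr P\<close> on the cone, which also yields global existence through a globally Lipschitz
  extension of the field.\<close>

section \<open>Lipschitz differential equations\<close>

text \<open>Two obstacles shape the proof. The field is singular at \<open>0\<close>, so Lipschitz
  theory says nothing about solutions starting there; and competing solutions are only required to
  be symmetric with nonzero trace away from \<open>0\<close>, so they may be indefinite. For nonzero
  initial values the remedy is the condition \<open>norm P < 2 * trace P\<close>. The Frobenius norm
  is at most the trace on the cone, so this condition describes a neighbourhood of the cone without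
  \<open>0\<close>; it lets the comparison run before positivity is known, and an exponential lower
  bound on the trace keeps solutions away from the singular point. For initial value
  \<open>0\<close>, growth of the norm is weighed against loss of trace, and oddness of the field
  reduces negative trace to positive trace. The remainder \<open>W\<close> only helps and is
  dropped, so the equation for \<open>D\<close> is used throughout as an inequality between
  quadratic forms.\<close>

text \<open>Gronwall with an integrating factor: \<open>exp (k * s) * \<phi> s\<close> has
  derivative \<open>exp (k * s) * (\<phi>' s + k * \<phi> s)\<close>, which is nonnegative. It
  yields uniqueness, the lower bound on the trace, and the vanishing of a form backwards in
  time.\<close>

lemma exp_weighted_mono:
  fixes \<phi> \<phi>' :: "real \<Rightarrow> real"
  assumes "a \<le> b"
    and der: "\<And>s. s \<in> {a..b} \<Longrightarrow> (\<phi> has_vector_derivative \<phi>' s) (at s within {a..b})"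
    and ge: "\<And>s. s \<in> {a..b} \<Longrightarrow> \<phi>' s \<ge> - k * \<phi> s"
  shows "exp (k * a) * \<phi> a \<le> exp (k * b) * \<phi> b"
proof (cases "a = b")
  case False
  define g where "g = (\<lambda>s. exp (k * s) * \<phi> s)"
  have d: "(g has_real_derivative exp (k * s) * (\<phi>' s + k * \<phi> s)) (at s within {a..b})"
    if "s \<in> {a..b}" for s
  proof -
    have "(\<phi> has_real_derivative \<phi>' s) (at s within {a..b})"
      using der[OF that] by (simp add: has_real_derivative_iff_has_vector_derivative)
    then show ?thesis
      unfolding g_def by (auto intro!: derivative_eq_intros simp: algebra_simps)
  qed
  have "g a \<le> g b"
  proof (rule DERIV_nonneg_imp_increasing_open[where f = g])
    show "a \<le> b" by fact
    show "continuous_on {a..b} g"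
      using d by (meson DERIV_continuous continuous_on_eq_continuous_within)
    fix s assume s: "a < s" "s < b"
    then have "at s within {a..b} = at s" by (intro at_within_Icc_at)
    then have "(g has_real_derivative exp (k * s) * (\<phi>' s + k * \<phi> s)) (at s)"
      using d[of s] s by simp
    moreover have "exp (k * s) * (\<phi>' s + k * \<phi> s) \<ge> 0"
      using ge[of s] s by simp
    ultimately show "\<exists>y. (g has_real_derivative y) (at s) \<and> 0 \<le> y" by blast
  qed
  then show ?thesis by (simp add: g_def)
qed simp

lemma has_vector_derivative_unique_Icc:
  fixes f :: "real \<Rightarrow> 'a::real_normed_vector"
  assumes "a < b" "s \<in> {a..b}"
    and "(f has_vector_derivative u) (at s within {a..b})"
    and "(f has_vector_derivative v) (at s within {a..b})"
  shows "u = v"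
  using vector_derivative_unique_within_closed_interval[of a b s f u v] assms
  unfolding cbox_interval by blast

lemma lipschitz_ode_unique:
  fixes F :: "'a::real_inner \<Rightarrow> 'a"
  assumes lip: "\<And>x y. norm (F x - F y) \<le> K * norm (x - y)"
    and x: "\<And>s. s \<in> {0..T} \<Longrightarrow> (x has_vector_derivative F (x s)) (at s within {0..T})"
    and y: "\<And>s. s \<in> {0..T} \<Longrightarrow> (y has_vector_derivative F (y s)) (at s within {0..T})"
    and "x 0 = y 0" and s: "s \<in> {0..T}"
  shows "x s = y s"
proof -
  \<comment> \<open>The minus sign turns the upper bound \<open>2 * K\<close> on the growth rate of
    the squared distance into the lower bound that \<open>exp_weighted_mono\<close> accepts;
    \<open>\<phi>\<close> starts at \<open>0\<close> and is never positive.\<close>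
  define \<phi> where "\<phi> = (\<lambda>r. - ((x r - y r) \<bullet> (x r - y r)))"
  have "exp ((-2*K) * 0) * \<phi> 0 \<le> exp ((-2*K) * s) * \<phi> s"
  proof (rule exp_weighted_mono[where \<phi>' = "\<lambda>r. - 2 * ((F (x r) - F (y r)) \<bullet> (x r - y r))"])
    show "0 \<le> s" using s by simp
    fix r assume r: "r \<in> {0..s}"
    then have rT: "r \<in> {0..T}" and sub: "{0..s} \<subseteq> {0..T}" using s by auto
    have d: "((\<lambda>r. x r - y r) has_vector_derivative F (x r) - F (y r)) (at r within {0..s})"
      by (intro has_vector_derivative_diff has_vector_derivative_within_subset[OF x[OF rT] sub]
          has_vector_derivative_within_subset[OF y[OF rT] sub])
    show "(\<phi> has_vector_derivative - 2 * ((F (x r) - F (y r)) \<bullet> (x r - y r))) (at r within {0..s})"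
      using has_vector_derivative_minus[OF bounded_bilinear.has_vector_derivative[OF bounded_bilinear_inner d d]]
      by (simp add: \<phi>_def inner_commute)
    have "(F (x r) - F (y r)) \<bullet> (x r - y r) \<le> norm (F (x r) - F (y r)) * norm (x r - y r)"
      by (rule norm_cauchy_schwarz)
    also have "\<dots> \<le> K * norm (x r - y r) * norm (x r - y r)"
      by (intro mult_right_mono lip) simp
    finally have "(F (x r) - F (y r)) \<bullet> (x r - y r) \<le> K * ((x r - y r) \<bullet> (x r - y r))"
      by (simp add: dot_square_norm power2_eq_square mult.assoc)
    then show "- 2 * ((F (x r) - F (y r)) \<bullet> (x r - y r)) \<ge> - (- 2 * K) * \<phi> r"
      by (simp add: \<phi>_def inner_minus_left)
  qed
  then have "0 \<le> exp ((-2*K) * s) * \<phi> s" using \<open>x 0 = y 0\<close> by (simp add: \<phi>_def)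
  then have "0 \<le> \<phi> s" unfolding zero_le_mult_iff by (metis exp_gt_zero not_le)
  moreover have "(x s - y s) \<bullet> (x s - y s) \<ge> 0" by simp
  ultimately have "(x s - y s) \<bullet> (x s - y s) = 0"
    unfolding \<phi>_def inner_minus_left by linarith
  then show ?thesis by simp
qed

text \<open>Picard iteration on the whole interval at once: the factorials in the bounds for
  successive differences make the series converge for every \<open>T\<close>, so no short-time
  solutions have to be glued.\<close>

lemma lipschitz_ode_exists:
  fixes F :: "'a::banach \<Rightarrow> 'a"
  assumes lip0: "\<And>x y. norm (F x - F y) \<le> K * norm (x - y)" and T: "0 \<le> T"
  obtains x where "x 0 = x0"
    "\<And>s. s \<in> {0..T} \<Longrightarrow> (x has_vector_derivative F (x s)) (at s within {0..T})"
proof -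
  define L where "L = \<bar>K\<bar> + 1"
  have L: "L > 0" by (simp add: L_def)
  have lip: "norm (F x - F y) \<le> L * norm (x - y)" for x y
  proof -
    have "K * norm (x - y) \<le> L * norm (x - y)" by (intro mult_right_mono) (auto simp: L_def)
    then show ?thesis using lip0[of x y] by linarith
  qed
  have "L-lipschitz_on UNIV F"
    using L lip by (auto simp: lipschitz_on_def dist_norm)
  then have contF: "continuous_on S F" for S
    using lipschitz_on_continuous_on continuous_on_subset by blast
  define X :: "nat \<Rightarrow> real \<Rightarrow> 'a" where "X = rec_nat (\<lambda>s. x0) (\<lambda>n Y s. x0 + integral {0..s} (\<lambda>r. F (Y r)))"
  have X0: "X 0 = (\<lambda>s. x0)" and XS: "X (Suc n) = (\<lambda>s. x0 + integral {0..s} (\<lambda>r. F (X n r)))" for n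
    by (simp_all add: X_def)
  have Xder': "continuous_on {0..T} (X n) \<Longrightarrow> s \<in> {0..T} \<Longrightarrow>
      (X (Suc n) has_vector_derivative F (X n s)) (at s within {0..T})" for n s
    unfolding XS
    by (auto intro!: derivative_eq_intros integral_has_vector_derivative
        continuous_on_compose2[OF contF])
  have Xcont: "continuous_on {0..T} (X n)" for n
  proof (induction n)
    case (Suc n)
    then show ?case
      using Xder' has_vector_derivative_continuous continuous_on_eq_continuous_within by blast
  qed (simp add: X0)
  note Xder = Xder'[OF Xcont]
  \<comment> \<open>Chosen so that \<open>E 0\<close> has derivative \<open>norm (F x0)\<close>,
    \<open>E (Suc n)\<close> has derivative \<open>L * E n\<close>, and all vanish at
    \<open>0\<close>: the majorants that the Lipschitz bound propagates from one difference to the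
    next.\<close>
  define E where "E = (\<lambda>n s. norm (F x0) * L ^ n * s ^ Suc n / fact (Suc n))"
  have Eder: "(E 0 has_vector_derivative norm (F x0)) (at s)"
    "(E (Suc n) has_vector_derivative L * E n s) (at s)" for n s
  proof -
    show "(E 0 has_vector_derivative norm (F x0)) (at s)"
      unfolding E_def has_real_derivative_iff_has_vector_derivative[symmetric]
      by (auto intro!: derivative_eq_intros)
    have "(E (Suc n) has_real_derivative norm (F x0) * L ^ Suc n * (real (Suc (Suc n)) * s ^ Suc n) / fact (Suc (Suc n))) (at s)"
      unfolding E_def by (auto intro!: derivative_eq_intros simp del: fact_Suc power_Suc)
    moreover have "norm (F x0) * L ^ Suc n * (real (Suc (Suc n)) * s ^ Suc n) / fact (Suc (Suc n)) = L * E n s"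
      unfolding E_def fact_Suc[of "Suc n"] by (simp add: field_simps del: fact_Suc of_nat_Suc)
    ultimately show "(E (Suc n) has_vector_derivative L * E n s) (at s)"
      by (simp add: has_real_derivative_iff_has_vector_derivative)
  qed
  have Econt: "continuous_on S (E n)" for S n
    unfolding E_def by (intro continuous_intros) auto
  have X_0: "X n 0 = x0" for n by (cases n) (simp_all add: X0 XS)
  have E_0: "E n 0 = 0" for n by (simp add: E_def)
  have XderI: "(X (Suc n) has_vector_derivative F (X n r)) (at r)" if "0 < r" "r < T" for n r
    using Xder[of r n] that at_within_Icc_at[of 0 r T] by simp
  have bound: "norm (X (Suc n) s - X n s) \<le> E n s" if s: "s \<in> {0..T}" for n s
    using s
  proof (induction n arbitrary: s)
    case 0
    show ?case
    proof (cases "s = 0")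
      case False
      have "norm ((X 1 s - X 0 s) - (X 1 0 - X 0 0)) \<le> E 0 s - E 0 0"
      proof (rule differentiable_bound_general[where f' = "\<lambda>r. F x0 - 0"])
        show "0 < s" using 0 False by simp
        show "continuous_on {0..s} (\<lambda>s. X 1 s - X 0 s)"
          using 0 by (intro continuous_intros continuous_on_subset[OF Xcont]) auto
        fix r assume r: "0 < r" "r < s"
        show "((\<lambda>s. X 1 s - X 0 s) has_vector_derivative F x0 - 0) (at r)"
          using XderI[of r 0] r 0 by (intro has_vector_derivative_diff) (auto simp: X0)
      qed (use Eder Econt in auto)
      then show ?thesis by (simp add: X_0 E_0)
    qed (simp add: X_0 E_0)
  next
    case (Suc n)
    show ?case
    proof (cases "s = 0")
      case False
      have "norm ((X (Suc (Suc n)) s - X (Suc n) s) - (X (Suc (Suc n)) 0 - X (Suc n) 0))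
          \<le> E (Suc n) s - E (Suc n) 0"
      proof (rule differentiable_bound_general[where f' = "\<lambda>r. F (X (Suc n) r) - F (X n r)"])
        show "0 < s" using Suc.prems False by simp
        show "continuous_on {0..s} (\<lambda>s. X (Suc (Suc n)) s - X (Suc n) s)"
          using Suc.prems by (intro continuous_intros continuous_on_subset[OF Xcont]) auto
        fix r assume r: "0 < r" "r < s"
        show "((\<lambda>s. X (Suc (Suc n)) s - X (Suc n) s) has_vector_derivative
            F (X (Suc n) r) - F (X n r)) (at r)"
          using r Suc.prems by (intro has_vector_derivative_diff XderI) auto
        have "norm (F (X (Suc n) r) - F (X n r)) \<le> L * norm (X (Suc n) r - X n r)"
          by (rule lip)
        also have "\<dots> \<le> L * E n r"
          using Suc.IH[of r] r Suc.prems L by (intro mult_left_mono) auto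
        finally show "norm (F (X (Suc n) r) - F (X n r)) \<le> L * E n r" .
      qed (use Eder Econt in auto)
      then show ?thesis by (simp add: X_0 E_0)
    qed (simp add: X_0 E_0)
  qed
  define x where "x = (\<lambda>s. x0 + (\<Sum>n. X (Suc n) s - X n s))"
  have sumE: "summable (\<lambda>n. E n T)"
  proof -
    have "summable (\<lambda>n. (norm (F x0) / L) * (inverse (fact (Suc n)) * (L * T) ^ Suc n))"
      by (intro summable_mult, subst summable_Suc_iff) (rule summable_exp)
    moreover have "(norm (F x0) / L) * (inverse (fact (Suc n)) * (L * T) ^ Suc n) = E n T" for n
      using L by (simp add: E_def field_simps power_mult_distrib)
    ultimately show ?thesis by simp
  qed
  have "uniform_limit {0..T} (\<lambda>n s. \<Sum>i<n. X (Suc i) s - X i s) (\<lambda>s. \<Sum>n. X (Suc n) s - X n s) sequentially"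
  proof (rule Weierstrass_m_test[OF _ sumE])
    fix n s assume s: "s \<in> {0..T}"
    have "E n s \<le> E n T"
      unfolding E_def using s L by (intro divide_right_mono mult_left_mono power_mono) auto
    then show "norm (X (Suc n) s - X n s) \<le> E n T" using bound[OF s, of n] by linarith
  qed
  moreover have "(\<Sum>i<n. X (Suc i) s - X i s) = X n s - x0" for n s
    using sum_lessThan_telescope[of "\<lambda>i. X i s" n] by (simp add: X0)
  ultimately have ul0: "uniform_limit {0..T} (\<lambda>n s. X n s - x0) (\<lambda>s. x s - x0) sequentially"
    by (simp add: x_def)
  have ul: "\<forall>\<^sub>F n in sequentially. \<forall>s\<in>{0..T}. norm (X n s - x s) < e" if "e > 0" for e
    using uniform_limitD[OF ul0 that] by (simp add: dist_norm)
  have ptw: "(\<lambda>n. X n s) \<longlonglongrightarrow> x s" if s: "s \<in> {0..T}" for s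
  proof (rule tendstoI)
    fix e :: real assume "e > 0"
    from ul[OF this] show "\<forall>\<^sub>F n in sequentially. dist (X n s) (x s) < e"
      by eventually_elim (use s in \<open>auto simp: dist_norm\<close>)
  qed
  \<comment> \<open>The derivative of \<open>X (Suc n)\<close> is \<open>F\<close> along
    \<open>X n\<close>, which converges uniformly to \<open>F\<close> along \<open>x\<close>; hence
    the shifted sequence is the one to differentiate.\<close>
  have "\<exists>g. \<forall>s\<in>{0..T}. (\<lambda>n. X (Suc n) s) \<longlonglongrightarrow> g s \<and>
      (g has_derivative (\<lambda>h. h *\<^sub>R F (x s))) (at s within {0..T})"
  proof (rule has_derivative_sequence[where f' = "\<lambda>n s h. h *\<^sub>R F (X n s)"])
    show "convex {0..T}" by simp
    show "(X (Suc n) has_derivative (\<lambda>h. h *\<^sub>R F (X n s))) (at s within {0..T})"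
      if "s \<in> {0..T}" for n s
      using Xder[OF that] by (simp add: has_vector_derivative_def)
    show "0 \<in> {0..T}" using T by simp
    show "(\<lambda>n. X (Suc n) 0) \<longlonglongrightarrow> x0" by (simp add: X_0)
    fix e :: real assume e: "e > 0"
    have "e / L > 0" using e L by simp
    from ul[OF this]
    show "\<forall>\<^sub>F n in sequentially. \<forall>s\<in>{0..T}. \<forall>h.
        norm (h *\<^sub>R F (X n s) - h *\<^sub>R F (x s)) \<le> e * norm h"
    proof eventually_elim
      case (elim n)
      show ?case
      proof (intro ballI allI)
        fix s h assume "s \<in> {0..T}"
        have "norm (F (X n s) - F (x s)) \<le> L * norm (X n s - x s)" by (rule lip)
        also have "\<dots> \<le> L * (e / L)" using elim[rule_format, OF \<open>s \<in> {0..T}\<close>] L by (intro mult_left_mono) auto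
        finally have "\<bar>h\<bar> * norm (F (X n s) - F (x s)) \<le> \<bar>h\<bar> * e"
          using L by (intro mult_left_mono) auto
        then show "norm (h *\<^sub>R F (X n s) - h *\<^sub>R F (x s)) \<le> e * norm h"
          by (simp add: scaleR_diff_right[symmetric] mult.commute)
      qed
    qed
  qed
  then obtain g where g: "\<And>s. s \<in> {0..T} \<Longrightarrow> (\<lambda>n. X (Suc n) s) \<longlonglongrightarrow> g s"
    "\<And>s. s \<in> {0..T} \<Longrightarrow> (g has_derivative (\<lambda>h. h *\<^sub>R F (x s))) (at s within {0..T})"
    by blast
  have gx: "g s = x s" if "s \<in> {0..T}" for s
    using LIMSEQ_unique[OF g(1)[OF that] LIMSEQ_Suc[OF ptw[OF that]]] .
  show ?thesis
  proof (rule that)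
    show "g 0 = x0" using LIMSEQ_unique[OF g(1)[of 0]] T by (simp add: X_0)
    show "(g has_vector_derivative F (g s)) (at s within {0..T})" if "s \<in> {0..T}" for s
      using g(2)[OF that] gx[OF that] by (simp add: has_vector_derivative_def)
  qed
qed

section \<open>Positive semidefinite matrices\<close>

lemma psd_coneD:
  assumes "X \<in> psd_cone"
  shows "transpose X = X" "0 \<le> x \<bullet> (X *v x)"
  using assms by (auto simp: psd_cone_def symmetric_matrices_def)

lemma inner_transpose_mult:
  fixes A :: "real^'n^'m"
  shows "x \<bullet> (transpose A *v y) = (A *v x) \<bullet> y"
  by (metis dot_lmul_matrix inner_commute transpose_matrix_vector)

lemma symmetric_inner:
  fixes X :: "real^'n^'n"
  assumes "transpose X = X"
  shows "x \<bullet> (X *v y) = (X *v x) \<bullet> y"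
  using inner_transpose_mult[of x X y] assms by simp

lemma inner_axis_mult_axis:
  fixes X :: "real^'n^'n"
  shows "axis i 1 \<bullet> (X *v axis j 1) = X $ i $ j"
  by (simp add: matrix_vector_mult_basis column_def inner_axis')

lemma trace_eq_sum_inner:
  fixes X :: "real^'n^'n"
  shows "trace X = (\<Sum>i\<in>UNIV. axis i 1 \<bullet> (X *v axis i 1))"
  by (simp add: trace_def inner_axis_mult_axis)

section \<open>Trace, transpose and Frobenius norm\<close>

lemma bounded_linear_trace: "bounded_linear (trace :: real^'n^'n \<Rightarrow> real)"
  unfolding trace_def
  by (intro bounded_linear_sum bounded_linear_compose[OF bounded_linear_vec_nth]
      bounded_linear_vec_nth)

lemma norm_matrix_power2:
  fixes A :: "real^'n^'m"
  shows "(norm A)\<^sup>2 = (\<Sum>i\<in>UNIV. \<Sum>j\<in>UNIV. (A $ i $ j)\<^sup>2)"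
  by (simp add: norm_vec_def L2_set_def sum_nonneg)

lemma norm_transpose: "norm (transpose A) = norm (A :: real^'n^'m)"
proof -
  have "(norm (transpose A))\<^sup>2 = (norm A)\<^sup>2"
    unfolding norm_matrix_power2 by (simp add: transpose_def) (rule sum.swap)
  then show ?thesis by simp
qed

lemma transpose_add: "transpose (A + B) = transpose A + transpose B"
  by (simp add: transpose_def vec_eq_iff)

lemma transpose_diff: "transpose (A - B) = transpose A - transpose (B :: real^'n^'m)"
  by (simp add: transpose_def vec_eq_iff)

lemma transpose_scaleR: "transpose (c *\<^sub>R A) = c *\<^sub>R transpose (A :: real^'n^'m)"
  by (simp add: transpose_def vec_eq_iff)

lemma bounded_linear_transpose: "bounded_linear (transpose :: real^'n^'m \<Rightarrow> real^'m^'n)"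
  by (rule bounded_linear_intro[where K = 1])
     (simp_all add: transpose_add transpose_scaleR norm_transpose)

lemma trace_scaleR: "trace (c *\<^sub>R A) = c * trace (A :: real^'n^'n)"
  by (simp add: trace_def sum_distrib_left)

lemma trace_mat: "trace (mat c :: real^'n^'n) = real CARD('n) * c"
  by (simp add: trace_def mat_def)

lemma trace_transpose: "trace (transpose A) = trace A"
  by (simp add: trace_def transpose_def)

lemma norm_matrix_vector_le:
  fixes A :: "real^'n^'m"
  shows "norm (A *v x) \<le> norm A * norm x"
proof -
  have "(norm (A *v x))\<^sup>2 = (\<Sum>i\<in>UNIV. (A $ i \<bullet> x)\<^sup>2)"
    by (simp add: norm_vec_def L2_set_def sum_nonneg matrix_vector_mul_component)
  also have "\<dots> \<le> (\<Sum>i\<in>UNIV. (norm (A $ i))\<^sup>2 * (norm x)\<^sup>2)"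
  proof (rule sum_mono)
    fix i
    show "(A $ i \<bullet> x)\<^sup>2 \<le> (norm (A $ i))\<^sup>2 * (norm x)\<^sup>2"
      using Cauchy_Schwarz_ineq2[of "A $ i" x]
      by (metis abs_ge_zero power2_abs power_mono power_mult_distrib)
  qed
  also have "\<dots> = (norm A * norm x)\<^sup>2"
    by (simp add: norm_vec_def[of A] L2_set_def sum_nonneg sum_distrib_right power_mult_distrib)
  finally show ?thesis by (rule power2_le_imp_le) simp
qed

lemma norm_matrix_mult_le:
  fixes A :: "real^'n^'m" and B :: "real^'p^'n"
  shows "norm (A ** B) \<le> norm A * norm B"
proof -
  have row: "(A ** B) $ i = transpose B *v (A $ i)" for i
    by (simp add: vec_eq_iff matrix_matrix_mult_def matrix_vector_mult_def transpose_def mult.commute)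
  have "(norm (A ** B))\<^sup>2 = (\<Sum>i\<in>UNIV. (norm (transpose B *v (A $ i)))\<^sup>2)"
    by (simp add: norm_vec_def[of "A ** B"] L2_set_def sum_nonneg row)
  also have "\<dots> \<le> (\<Sum>i\<in>UNIV. (norm (A $ i))\<^sup>2 * (norm B)\<^sup>2)"
  proof (rule sum_mono)
    fix i
    show "(norm (transpose B *v (A $ i)))\<^sup>2 \<le> (norm (A $ i))\<^sup>2 * (norm B)\<^sup>2"
      using norm_matrix_vector_le[of "transpose B" "A $ i"]
      by (metis mult.commute norm_ge_zero norm_transpose power_mono power_mult_distrib)
  qed
  also have "\<dots> = (norm A * norm B)\<^sup>2"
    by (simp add: norm_vec_def[of A] L2_set_def sum_nonneg sum_distrib_right power_mult_distrib)
  finally show ?thesis by (rule power2_le_imp_le) simp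
qed

lemma bounded_bilinear_matrix_mult:
  "bounded_bilinear ((**) :: real^'n^'m \<Rightarrow> real^'p^'n \<Rightarrow> real^'p^'m)"
proof
  fix A A' :: "real^'n^'m" and B B' :: "real^'p^'n" and r :: real
  show "(A + A') ** B = A ** B + A' ** B"
    by (vector matrix_matrix_mult_def sum.distrib[symmetric] field_simps)
  show "A ** (B + B') = A ** B + A ** B'"
    by (rule matrix_add_ldistrib)
  show "r *\<^sub>R A ** B = r *\<^sub>R (A ** B)"
    by (simp add: scalar_matrix_assoc)
  show "A ** r *\<^sub>R B = r *\<^sub>R (A ** B)"
    by (simp add: matrix_scalar_ac scalar_matrix_assoc)
  show "\<exists>K. \<forall>A B. norm ((A :: real^'n^'m) ** (B :: real^'p^'n)) \<le> norm A * norm B * K"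
    by (intro exI[of _ 1] allI) (simp add: norm_matrix_mult_le)
qed

interpretation matrix_mult: bounded_bilinear
  "(**) :: real^'n^'m \<Rightarrow> real^'p^'n \<Rightarrow> real^'p^'m"
  by (rule bounded_bilinear_matrix_mult)

lemma bounded_bilinear_matrix_vector_mult:
  "bounded_bilinear ((*v) :: real^'n^'m \<Rightarrow> real^'n \<Rightarrow> real^'m)"
proof
  fix A A' :: "real^'n^'m" and x y :: "real^'n" and r :: real
  show "\<exists>K. \<forall>A x. norm ((A :: real^'n^'m) *v (x :: real^'n)) \<le> norm A * norm x * K"
    by (intro exI[of _ 1] allI) (simp add: norm_matrix_vector_le)
  show "r *\<^sub>R A *v x = r *\<^sub>R (A *v x)"
    by (simp add: scaleR_matrix_vector_assoc)
qed (simp_all add: algebra_simps)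

lemma abs_quadratic_form_le:
  fixes X :: "real^'n^'n"
  shows "\<bar>x \<bullet> (X *v x)\<bar> \<le> norm X * (norm x)\<^sup>2"
proof -
  have "\<bar>x \<bullet> (X *v x)\<bar> \<le> norm x * norm (X *v x)" by (rule Cauchy_Schwarz_ineq2)
  also have "\<dots> \<le> norm x * (norm X * norm x)"
    by (intro mult_left_mono norm_matrix_vector_le) simp
  finally show ?thesis by (simp add: power2_eq_square mult_ac)
qed

section \<open>Inequalities for positive semidefinite forms\<close>

lemma psd_Cauchy_Schwarz:
  fixes X :: "real^'n^'n"
  assumes X: "X \<in> psd_cone"
  shows "(x \<bullet> (X *v y))\<^sup>2 \<le> (x \<bullet> (X *v x)) * (y \<bullet> (X *v y))"
proof -
  define a b c where "a = x \<bullet> (X *v x)" and "b = x \<bullet> (X *v y)" and "c = y \<bullet> (X *v y)"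
  have sym: "y \<bullet> (X *v x) = b"
    using symmetric_inner[OF psd_coneD(1)[OF X], of y x] by (simp add: b_def inner_commute)
  have q: "0 \<le> a + 2 * r * b + r\<^sup>2 * c" for r
    using psd_coneD(2)[OF X, of "x + r *\<^sub>R y"] sym
    by (simp add: a_def b_def c_def algebra_simps inner_add_left inner_add_right
        power2_eq_square)
  have "0 \<le> a" "0 \<le> c" using psd_coneD(2)[OF X] by (auto simp: a_def c_def)
  have "b\<^sup>2 \<le> a * c"
  proof (cases "c = 0")
    case True
    have "b = 0"
    proof (rule ccontr)
      assume "b \<noteq> 0"
      \<comment> \<open>With \<open>c = 0\<close> the quadratic is affine in \<open>r\<close>, and
        this \<open>r\<close> gives it the value \<open>-1\<close>.\<close>
      then show False using q[of "- (a + 1) / (2 * b)"] True by (simp add: field_simps)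
    qed
    then show ?thesis using True by simp
  next
    case False
    then have "0 \<le> c * (a + 2 * (- b / c) * b + (- b / c)\<^sup>2 * c)"
      using q[of "- b / c"] \<open>0 \<le> c\<close> by (intro mult_nonneg_nonneg) auto
    also have "\<dots> = a * c - b\<^sup>2"
      using False by (simp add: field_simps power2_eq_square)
    finally show ?thesis by simp
  qed
  then show ?thesis by (simp add: a_def b_def c_def)
qed

lemma psd_trace_nonneg: "X \<in> psd_cone \<Longrightarrow> 0 \<le> trace X"
  by (simp add: trace_eq_sum_inner sum_nonneg psd_coneD(2))

text \<open>Cauchy-Schwarz on coordinate vectors bounds the square of each entry by a product of two
  diagonal entries, and the sum of these products factors as the squared trace.\<close>

lemma psd_norm_le_trace:
  assumes X: "X \<in> psd_cone"
  shows "norm X \<le> trace X"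
proof -
  have "(norm X)\<^sup>2 = (\<Sum>i\<in>UNIV. \<Sum>j\<in>UNIV. (X $ i $ j)\<^sup>2)"
    by (rule norm_matrix_power2)
  also have "\<dots> \<le> (\<Sum>i\<in>UNIV. \<Sum>j\<in>UNIV. X $ i $ i * X $ j $ j)"
    using psd_Cauchy_Schwarz[OF X, of "axis i 1" "axis j 1" for i j]
    by (intro sum_mono) (simp add: inner_axis_mult_axis)
  also have "\<dots> = (trace X)\<^sup>2"
    by (simp add: trace_def power2_eq_square sum_product)
  finally show ?thesis
    by (rule power2_le_imp_le) (rule psd_trace_nonneg[OF X])
qed

lemma psd_trace_pos: "X \<in> psd_cone \<Longrightarrow> X \<noteq> 0 \<Longrightarrow> 0 < trace X"
  using psd_norm_le_trace[of X] zero_less_norm_iff[of X] by linarith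

text \<open>The matrix inequality \<open>X^2 \<le> (tr X) X\<close> in vector form. Cauchy-Schwarz
  for the form, applied to \<open>X *v x\<close> and \<open>x\<close>, gives it after division by
  the squared norm of \<open>X *v x\<close>. In particular a vector on which the form vanishes lies
  in the kernel.\<close>

lemma psd_norm_mult_le:
  assumes X: "X \<in> psd_cone"
  shows "(norm (X *v x))\<^sup>2 \<le> trace X * (x \<bullet> (X *v x))"
proof (cases "X *v x = 0")
  case True
  then show ?thesis by simp
next
  case False
  define n where "n = (norm (X *v x))\<^sup>2"
  have n: "n > 0" using False by (simp add: n_def)
  have "n\<^sup>2 = ((X *v x) \<bullet> (X *v x))\<^sup>2" by (simp add: n_def dot_square_norm)
  also have "\<dots> \<le> ((X *v x) \<bullet> (X *v (X *v x))) * (x \<bullet> (X *v x))"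
    by (rule psd_Cauchy_Schwarz[OF X])
  also have "\<dots> \<le> (trace X * n) * (x \<bullet> (X *v x))"
  proof (rule mult_right_mono)
    have "(X *v x) \<bullet> (X *v (X *v x)) \<le> norm X * n"
      using abs_quadratic_form_le[of "X *v x" X] by (simp add: n_def)
    also have "\<dots> \<le> trace X * n" using n psd_norm_le_trace[OF X] by (intro mult_right_mono) auto
    finally show "(X *v x) \<bullet> (X *v (X *v x)) \<le> trace X * n" .
  qed (rule psd_coneD(2)[OF X])
  finally have "n * n \<le> n * (trace X * (x \<bullet> (X *v x)))" by (simp add: power2_eq_square mult_ac)
  then have "n \<le> trace X * (x \<bullet> (X *v x))" using n by (rule mult_left_le_imp_le)
  then show ?thesis by (simp add: n_def)
qed

lemma closed_psd_cone: "closed (psd_cone :: (real^'n^'n) set)"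
proof -
  have eq: "psd_cone = (\<Inter>i j. {X :: real^'n^'n. X $ i $ j = X $ j $ i}) \<inter>
      (\<Inter>x. {X. 0 \<le> x \<bullet> (X *v x)})"
    by (auto simp: psd_cone_def symmetric_matrices_def transpose_def vec_eq_iff)
  have c: "continuous_on UNIV (\<lambda>X :: real^'n^'n. x \<bullet> (X *v x))" for x
    by (intro continuous_intros bounded_bilinear.continuous_on[OF bounded_bilinear_matrix_vector_mult])
  show ?thesis
    unfolding eq
    by (intro closed_Int closed_INT ballI closed_Collect_eq closed_Collect_le continuous_intros c)
qed

lemma pd_matrix_invertible:
  assumes "R \<in> pd_matrices"
  shows "invertible R"
proof -
  have "x = 0" if "R *v x = 0" for x
    using assms that by (force simp: pd_matrices_def)
  then show ?thesis
    using matrix_left_invertible_ker[of R] invertible_left_inverse by blast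
qed

text \<open>With \<open>y = matrix_inv R *v (transpose B *v x)\<close> the form becomes
  \<open>y \<bullet> (R *v y)\<close>, so positivity of \<open>R\<close> itself is enough.\<close>

lemma psd_congruence_inverse:
  fixes R :: "real^'p^'p" and B :: "real^'p^'n"
  assumes R: "R \<in> pd_matrices"
  shows "B ** matrix_inv R ** transpose B \<in> psd_cone"
proof -
  let ?S = "matrix_inv R"
  have inv: "R ** ?S = mat 1" "?S ** R = mat 1"
    using someI_ex[OF pd_matrix_invertible[OF R, unfolded invertible_def]]
    by (auto simp: matrix_inv_def)
  have Rs: "transpose R = R" using R by (simp add: pd_matrices_def symmetric_matrices_def)
  have "transpose ?S = transpose ?S ** (R ** ?S)" by (simp add: inv)
  also have "\<dots> = transpose (R ** ?S) ** ?S"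
    by (simp add: matrix_transpose_mul Rs matrix_mul_assoc)
  finally have S: "transpose ?S = ?S" by (simp add: inv transpose_mat)
  show ?thesis
    unfolding psd_cone_def symmetric_matrices_def
  proof (intro CollectI conjI allI)
    show "transpose (B ** ?S ** transpose B) = B ** ?S ** transpose B"
      by (simp add: matrix_transpose_mul S matrix_mul_assoc)
    fix x
    define y where "y = ?S *v (transpose B *v x)"
    have Ry: "R *v y = transpose B *v x"
      by (simp add: y_def matrix_vector_mul_assoc inv)
    have "x \<bullet> ((B ** ?S ** transpose B) *v x) = x \<bullet> (B *v y)"
      by (simp add: y_def matrix_vector_mul_assoc matrix_mul_assoc del: transpose_matrix_vector)
    also have "\<dots> = (transpose B *v x) \<bullet> y"
      using inner_transpose_mult[of x "transpose B" y] by simp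
    also have "\<dots> = y \<bullet> (R *v y)" by (simp add: Ry inner_commute)
    finally show "0 \<le> x \<bullet> ((B ** ?S ** transpose B) *v x)"
      using R by (cases "y = 0") (auto simp: pd_matrices_def intro: less_imp_le)
  qed
qed

section \<open>Linear differential inequalities on the cone\<close>

lemma has_vector_derivative_quadratic_form:
  fixes X :: "real \<Rightarrow> real^'n^'n"
  assumes "(X has_vector_derivative X') (at s within S)"
  shows "((\<lambda>r. x \<bullet> (X r *v x)) has_vector_derivative x \<bullet> (X' *v x)) (at s within S)"
proof -
  have "bounded_linear (\<lambda>Y. x \<bullet> (Y *v x))"
    by (rule bounded_linear_compose[OF bounded_linear_inner_right
        bounded_bilinear.bounded_linear_left[OF bounded_bilinear_matrix_vector_mult]])
  from bounded_linear.has_vector_derivative[OF this assms] show ?thesis .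
qed

text \<open>If \<open>X\<close> leaves the cone, \<open>X + \<epsilon> exp (\<kappa> s) I\<close> leaves it at a first positive time, along some
  kernel vector \<open>x\<close>. For \<open>\<kappa>\<close> large its quadratic form at \<open>x\<close> is strictly increasing there,
  although it was positive before and vanishes now.\<close>

lemma psd_invariant:
  fixes X X' :: "real \<Rightarrow> real^'n^'n"
  assumes der: "\<And>s. s \<in> {0..T} \<Longrightarrow> (X has_vector_derivative X' s) (at s within {0..T})"
    and sym: "\<And>s. s \<in> {0..T} \<Longrightarrow> transpose (X s) = X s"
    and init: "X 0 \<in> psd_cone"
    and drift: "\<And>s x. s \<in> {0..T} \<Longrightarrow>
      2 * ((X s *v x) \<bullet> l s x) + trace (X s) * v s x \<le> x \<bullet> (X' s *v x)"
    and l: "\<And>s x. s \<in> {0..T} \<Longrightarrow> norm (l s x) \<le> K * norm x"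
    and v: "\<And>s x. s \<in> {0..T} \<Longrightarrow> 0 \<le> v s x" "\<And>s x. s \<in> {0..T} \<Longrightarrow> v s x \<le> K * (norm x)\<^sup>2"
    and K: "0 \<le> K" and s: "s \<in> {0..T}"
  shows "X s \<in> psd_cone"
proof -
  \<comment> \<open>At the first exit \<open>X s1 *v x1\<close> equals \<open>- e s1\<close> times
    the unit vector \<open>x1\<close>, and \<open>trace (X s1)\<close> is at least
    \<open>- CARD('n) * e s1\<close>. The gain term thus costs at most \<open>2 * K * e s1\<close>
    and the trace term at most \<open>CARD('n) * K * e s1\<close>; the added 1 makes the increase
    strict.\<close>
  define \<kappa> where "\<kappa> = (2 + real CARD('n)) * K + 1"
  have pos: "0 < x \<bullet> (X s *v x) + \<epsilon> * exp (\<kappa> * s) * (norm x)\<^sup>2"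
    if \<epsilon>: "\<epsilon> > 0" and s: "s \<in> {0..T}" and "x \<noteq> 0" for \<epsilon> s and x :: "real^'n"
  proof (rule ccontr)
    assume neg: "\<not> ?thesis"
    define e where "e = (\<lambda>s. \<epsilon> * exp (\<kappa> * s))"
    have e: "e s > 0" for s using \<epsilon> by (simp add: e_def)
    define g where "g = (\<lambda>s x. x \<bullet> (X s *v x) + e s * (norm x)\<^sup>2)"
    have Xc: "continuous_on {0..T} X"
      using der has_vector_derivative_continuous continuous_on_eq_continuous_within by blast
    \<comment> \<open>Unit vectors suffice by homogeneity, and on them the bad set is compact, so an
      earliest bad time exists.\<close>
    define S where "S = {0..T} \<times> sphere (0 :: real^'n) 1"
    have Sc: "compact S" unfolding S_def by (intro compact_Times) auto
    have gc: "continuous_on S (\<lambda>z. g (fst z) (snd z))"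
      unfolding g_def e_def S_def
      by (intro continuous_intros continuous_on_compose2[OF Xc]
          bounded_bilinear.continuous_on[OF bounded_bilinear_matrix_vector_mult]) auto
    define Z where "Z = {z \<in> S. g (fst z) (snd z) \<le> 0}"
    have "Z = S \<inter> (\<lambda>z. g (fst z) (snd z)) -` {..0}" by (auto simp: Z_def)
    then have "closed Z"
      using continuous_closed_preimage[OF gc compact_imp_closed[OF Sc] closed_atMost] by simp
    then have Zc: "compact Z"
      using compact_Int_closed[OF Sc, of Z] by (simp add: Z_def inf_absorb2 Int_def conj_commute)
    have ghom: "g s (r *\<^sub>R y) = r\<^sup>2 * g s y" for s r y
      by (simp add: g_def matrix_vector_mult_scaleR algebra_simps power2_eq_square power_mult_distrib)
    have "g s x \<le> 0" using neg by (simp add: g_def e_def)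
    then have "g s ((1 / norm x) *\<^sub>R x) \<le> 0" by (simp add: ghom mult_nonneg_nonpos)
    then have "(s, (1 / norm x) *\<^sub>R x) \<in> Z"
      using s \<open>x \<noteq> 0\<close> by (simp add: Z_def S_def)
    then have "Z \<noteq> {}" by blast
    then have "\<exists>z\<in>Z. \<forall>w\<in>Z. fst z \<le> fst w"
      by (intro continuous_attains_inf Zc continuous_intros)
    then obtain s1 x1 where z: "(s1, x1) \<in> Z" and min: "\<And>r y. (r, y) \<in> Z \<Longrightarrow> s1 \<le> r"
      by fastforce
    have s1: "s1 \<in> {0..T}" and x1: "norm x1 = 1" and g1: "g s1 x1 \<le> 0"
      using z by (auto simp: Z_def S_def)
    have before: "0 < g r y" if "r \<in> {0..<s1}" "y \<noteq> 0" for r y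
    proof -
      have "(r, (1 / norm y) *\<^sub>R y) \<notin> Z" using min that(1) by fastforce
      then have "0 < g r ((1 / norm y) *\<^sub>R y)"
        using that s1 by (auto simp: Z_def S_def)
      then show ?thesis by (simp add: ghom zero_less_mult_iff)
    qed
    have "0 < g 0 x1"
      using psd_coneD(2)[OF init, of x1] e[of 0] x1 by (simp add: g_def)
    then have "s1 \<noteq> 0" using g1 by auto
    then have s1pos: "0 < s1" using s1 by simp
    define Y where "Y = X s1 + mat (e s1)"
    have matv: "mat c *v y = c *\<^sub>R y" for c and y :: "real^'n"
      by (simp add: vec_eq_iff mat_def matrix_vector_mult_def if_distrib if_distribR cong: if_cong)
    have Yg: "y \<bullet> (Y *v y) = g s1 y" for y
      by (simp add: Y_def g_def algebra_simps inner_add_right matv dot_square_norm)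
    have "0 \<le> g s1 y" for y
    proof (cases "y = 0")
      case False
      have c: "continuous_on {0..T} (\<lambda>r. g r y)"
        unfolding g_def e_def
        by (intro continuous_intros continuous_on_compose2[OF Xc]
          bounded_bilinear.continuous_on[OF bounded_bilinear_matrix_vector_mult]) auto
      have cl: "closure {0..<s1} = {0..s1}" using s1pos by simp
      show ?thesis
      proof (rule continuous_ge_on_closure[of "{0..<s1}" "\<lambda>r. g r y"])
        show "continuous_on (closure {0..<s1}) (\<lambda>r. g r y)"
          unfolding cl using s1 by (intro continuous_on_subset[OF c]) auto
      qed (use cl s1pos before[OF _ False] in \<open>auto intro: less_imp_le\<close>)
    qed (simp add: g_def)
    then have Y: "Y \<in> psd_cone"
      using sym[OF s1]
      by (simp add: psd_cone_def symmetric_matrices_def Yg)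
         (simp add: Y_def transpose_def mat_def vec_eq_iff)
    have "(norm (Y *v x1))\<^sup>2 \<le> 0"
      using psd_norm_mult_le[OF Y, of x1] g1 psd_trace_nonneg[OF Y]
      unfolding Yg by (meson mult_nonneg_nonpos order_trans)
    then have "Y *v x1 = 0" by simp
    then have Xx1: "X s1 *v x1 = - e s1 *\<^sub>R x1"
      by (simp add: Y_def algebra_simps matv eq_neg_iff_add_eq_0)
    have tr: "trace (X s1) = trace Y - real CARD('n) * e s1"
      by (simp add: Y_def trace_add trace_mat)
    have "(X s1 *v x1) \<bullet> l s1 x1 \<ge> - e s1 * K"
    proof -
      have "x1 \<bullet> l s1 x1 \<le> norm x1 * norm (l s1 x1)" by (rule norm_cauchy_schwarz)
      also have "\<dots> \<le> K" using l[OF s1, of x1] x1 by simp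
      finally show ?thesis using e[of s1] by (simp add: Xx1)
    qed
    moreover have "trace (X s1) * v s1 x1 \<ge> - real CARD('n) * e s1 * K"
    proof -
      have "real CARD('n) * e s1 * v s1 x1 \<le> real CARD('n) * e s1 * K"
        using v(2)[OF s1, of x1] x1 e[of s1] by (intro mult_left_mono) auto
      moreover have "0 \<le> trace Y * v s1 x1"
        using psd_trace_nonneg[OF Y] v(1)[OF s1] by simp
      ultimately show ?thesis by (simp add: tr algebra_simps)
    qed
    ultimately have "x1 \<bullet> (X' s1 *v x1) \<ge> - (2 + real CARD('n)) * K * e s1"
      using drift[OF s1, of x1] by (simp add: algebra_simps)
    then have dpos: "0 < x1 \<bullet> (X' s1 *v x1) + \<kappa> * e s1"
      using e[of s1] by (simp add: \<kappa>_def algebra_simps)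
    have "((\<lambda>r. g r x1) has_real_derivative x1 \<bullet> (X' s1 *v x1) + \<kappa> * e s1) (at s1 within {0..T})"
    proof -
      have "((\<lambda>r. x1 \<bullet> (X r *v x1)) has_real_derivative x1 \<bullet> (X' s1 *v x1)) (at s1 within {0..T})"
        using has_vector_derivative_quadratic_form[OF der[OF s1], of x1]
        by (simp add: has_real_derivative_iff_has_vector_derivative)
      then show ?thesis
        unfolding g_def e_def using x1 by (auto intro!: derivative_eq_intros)
    qed
    from has_real_derivative_pos_inc_left[OF this dpos]
    obtain d where d: "d > 0" "\<And>h. h > 0 \<Longrightarrow> s1 - h \<in> {0..T} \<Longrightarrow> h < d \<Longrightarrow> g (s1 - h) x1 < g s1 x1"
      by auto
    define h where "h = min (d / 2) s1"
    have "0 < h" "h < d" "h \<le> s1" using d(1) s1pos by (auto simp: h_def)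
    then have "g (s1 - h) x1 < g s1 x1" using d(2)[of h] s1 by auto
    moreover have "0 < g (s1 - h) x1"
      using \<open>0 < h\<close> \<open>h \<le> s1\<close> x1 by (intro before) auto
    ultimately show False using g1 by simp
  qed
  have "0 \<le> x \<bullet> (X s *v x)" for x
  proof (cases "x = 0")
    case False
    have "0 \<le> x \<bullet> (X s *v x) + \<delta>" if "\<delta> > 0" for \<delta>
      using pos[of "\<delta> / (exp (\<kappa> * s) * (norm x)\<^sup>2)", OF _ s False] that False by simp
    then show ?thesis by (rule field_le_epsilon)
  qed simp
  then show ?thesis using sym[OF s] by (simp add: psd_cone_def symmetric_matrices_def)
qed

text \<open>Summing the drift over the coordinate axes gives the derivative of the trace. On the
  cone the norm is at most the trace, so each axis costs at most \<open>2 * K\<close> times the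
  trace, whence the factor \<open>CARD('n)\<close>. A trace that starts positive therefore never
  reaches \<open>0\<close>.\<close>

lemma trace_exp_lower_bound:
  fixes X X' :: "real \<Rightarrow> real^'n^'n"
  assumes der: "\<And>s. s \<in> {0..T} \<Longrightarrow> (X has_vector_derivative X' s) (at s within {0..T})"
    and psd: "\<And>s. s \<in> {0..T} \<Longrightarrow> X s \<in> psd_cone"
    and drift: "\<And>s x. s \<in> {0..T} \<Longrightarrow>
      2 * ((X s *v x) \<bullet> l s x) + trace (X s) * v s x \<le> x \<bullet> (X' s *v x)"
    and l: "\<And>s x. s \<in> {0..T} \<Longrightarrow> norm (l s x) \<le> K * norm x"
    and v: "\<And>s x. s \<in> {0..T} \<Longrightarrow> 0 \<le> v s x"
    and K: "0 \<le> K" and s: "s \<in> {0..T}"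
  shows "trace (X 0) \<le> exp (2 * real CARD('n) * K * s) * trace (X s)"
proof -
  have "exp (2 * real CARD('n) * K * 0) * trace (X 0) \<le> exp (2 * real CARD('n) * K * s) * trace (X s)"
  proof (rule exp_weighted_mono[where \<phi>' = "\<lambda>r. trace (X' r)"])
    show "0 \<le> s" using s by simp
    fix r assume "r \<in> {0..s}"
    then have r: "r \<in> {0..T}" and sub: "{0..s} \<subseteq> {0..T}" using s by auto
    show "((\<lambda>r. trace (X r)) has_vector_derivative trace (X' r)) (at r within {0..s})"
      by (intro bounded_linear.has_vector_derivative[OF bounded_linear_trace]
          has_vector_derivative_within_subset[OF der[OF r] sub])
    have "- (2 * K) * trace (X r) \<le> axis i 1 \<bullet> (X' r *v axis i 1)" for i
    proof -
      let ?x = "axis i (1::real)"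
      have "- ((X r *v ?x) \<bullet> l r ?x) \<le> norm (X r *v ?x) * norm (l r ?x)"
        using Cauchy_Schwarz_ineq2[of "X r *v ?x" "l r ?x"] by linarith
      also have "\<dots> \<le> trace (X r) * K"
      proof (rule mult_mono)
        show "norm (X r *v ?x) \<le> trace (X r)"
          using norm_matrix_vector_le[of "X r" ?x] psd_norm_le_trace[OF psd[OF r]]
          by (simp add: norm_axis_1)
        show "norm (l r ?x) \<le> K" using l[OF r, of ?x] by (simp add: norm_axis_1)
      qed (use psd_trace_nonneg[OF psd[OF r]] in auto)
      finally have "- (trace (X r) * K) \<le> (X r *v ?x) \<bullet> l r ?x" by linarith
      moreover have "0 \<le> trace (X r) * v r ?x"
        using psd_trace_nonneg[OF psd[OF r]] v[OF r] by simp
      ultimately show ?thesis using drift[OF r, of ?x] by (simp add: algebra_simps)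
    qed
    then have "(\<Sum>i\<in>(UNIV::'n set). - (2 * K) * trace (X r)) \<le> trace (X' r)"
      unfolding trace_eq_sum_inner[of "X' r"] by (rule sum_mono)
    then show "- (2 * real CARD('n) * K) * trace (X r) \<le> trace (X' r)"
      by (simp add: algebra_simps)
  qed
  then show ?thesis by simp
qed

section \<open>Observability\<close>

lemma matrix_power_Suc_right: "matrix_power A (Suc k) = matrix_power A k ** A"
  unfolding matrix_power_def
  by (induction k) (simp_all add: matrix_mul_assoc)

lemma observableD:
  fixes A :: "real^'n^'n" and C :: "real^'n^'m"
  assumes "observable A C" and zero: "\<And>k. C *v (matrix_power A k *v x) = 0"
  shows "x = 0"
proof -
  have inj: "inj ((*v) (observability_matrix A C))"
    using assms(1) by (simp add: observable_def full_rank_injective)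
  have "observability_matrix A C *v x = 0"
  proof (simp add: vec_eq_iff, intro allI)
    fix k :: 'n and i :: 'm
    let ?N = "C ** matrix_power A (to_nat_on UNIV k)"
    have "(observability_matrix A C *v x) $ (k, i) = (?N *v x) $ i"
      by (simp add: observability_matrix_def matrix_vector_mult_def)
    also have "?N *v x = 0"
      using zero by (simp add: matrix_vector_mul_assoc[symmetric])
    finally show "(observability_matrix A C *v x) $ (k, i) = 0" by simp
  qed
  then show ?thesis using injD[OF inj, of x 0] by simp
qed

text \<open>Each identity \<open>C A^k y = 0\<close> is differentiated to obtain the next one, up to
  the factor \<open>\<beta>\<close>; derivatives within a nondegenerate closed interval are unique
  even at its endpoints.\<close>

lemma observable_trajectory_eq_0:
  fixes A :: "real^'n^'n" and C :: "real^'n^'m"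
  assumes obs: "observable A C" and "\<beta> \<noteq> 0" and T: "0 < T"
    and der: "\<And>s. s \<in> {0..T} \<Longrightarrow> (y has_vector_derivative \<beta> *\<^sub>R (A *v y s)) (at s within {0..T})"
    and zero: "\<And>s. s \<in> {0..T} \<Longrightarrow> C *v y s = 0" and s: "s \<in> {0..T}"
  shows "y s = 0"
proof -
  have "\<forall>s\<in>{0..T}. C *v (matrix_power A k *v y s) = 0" for k
  proof (induction k)
    case 0
    show ?case using zero by (simp add: matrix_power_def)
  next
    case (Suc k)
    show ?case
    proof
      fix s assume s: "s \<in> {0..T}"
      let ?N = "C ** matrix_power A k"
      have d1: "((\<lambda>s. ?N *v y s) has_vector_derivative ?N *v (\<beta> *\<^sub>R (A *v y s))) (at s within {0..T})"
        by (rule bounded_linear.has_vector_derivative[OF matrix_vector_mul_bounded_linear der[OF s]])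
      have d2: "((\<lambda>s. ?N *v y s) has_vector_derivative 0) (at s within {0..T})"
        by (rule has_vector_derivative_transform[OF s _ has_vector_derivative_const[of 0]])
           (use Suc in \<open>simp add: matrix_vector_mul_assoc[symmetric]\<close>)
      have "?N *v (\<beta> *\<^sub>R (A *v y s)) = 0"
        by (rule has_vector_derivative_unique_Icc[OF T s d1 d2])
      then show "C *v (matrix_power A (Suc k) *v y s) = 0"
        using \<open>\<beta> \<noteq> 0\<close>
        by (simp add: matrix_vector_mult_scaleR matrix_power_Suc_right matrix_vector_mul_assoc
            matrix_mul_assoc)
    qed
  qed
  then show ?thesis using observableD[OF obs] s by blast
qed

text \<open>Time reversal of an initial value problem: the kernel vector to be excluded is given at
  the final time, so the trajectory has to be prescribed there.\<close>

lemma linear_ode_terminal_value: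
  fixes A :: "real^'n^'n"
  assumes "0 \<le> T"
  obtains y where "y T = x"
    "\<And>s. s \<in> {0..T} \<Longrightarrow> (y has_vector_derivative \<beta> *\<^sub>R (A *v y s)) (at s within {0..T})"
proof -
  have lip: "norm ((- \<beta>) *\<^sub>R (A *v a) - (- \<beta>) *\<^sub>R (A *v b)) \<le> (\<bar>\<beta>\<bar> * norm A) * norm (a - b)"
    for a b
  proof -
    have "norm ((- \<beta>) *\<^sub>R (A *v a) - (- \<beta>) *\<^sub>R (A *v b)) = \<bar>\<beta>\<bar> * norm (A *v (a - b))"
      by (metis abs_minus_cancel matrix_vector_mult_diff_distrib norm_scaleR scaleR_diff_right)
    also have "\<dots> \<le> \<bar>\<beta>\<bar> * (norm A * norm (a - b))"
      by (intro mult_left_mono norm_matrix_vector_le) simp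
    finally show ?thesis by (simp add: mult.assoc)
  qed
  obtain z where z0: "z 0 = x"
    and z: "\<And>s. s \<in> {0..T} \<Longrightarrow> (z has_vector_derivative (- \<beta>) *\<^sub>R (A *v z s)) (at s within {0..T})"
    using lipschitz_ode_exists[of "\<lambda>a. (- \<beta>) *\<^sub>R (A *v a)", OF lip \<open>0 \<le> T\<close>, of x] by auto
  show ?thesis
  proof (rule that[of "\<lambda>s. z (T - s)"])
    fix s assume s: "s \<in> {0..T}"
    have f: "((\<lambda>s. T - s) has_vector_derivative - 1) (at s within {0..T})"
      by (auto intro!: derivative_eq_intros)
    have im: "(\<lambda>s. T - s) ` {0..T} = {0..T}" by (auto simp: image_def intro: bexI[of _ "T - _"])
    have "(z has_vector_derivative (- \<beta>) *\<^sub>R (A *v z (T - s))) (at (T - s) within (\<lambda>s. T - s) ` {0..T})"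
      unfolding im using z[of "T - s"] s by simp
    from vector_diff_chain_within[OF f this]
    show "((\<lambda>s. z (T - s)) has_vector_derivative \<beta> *\<^sub>R (A *v z (T - s))) (at s within {0..T})"
      by (simp add: o_def)
  qed (simp add: z0)
qed

text \<open>Along \<open>y' = - \<alpha> A y\<close> the form \<open>y \<bullet> D y\<close> can decrease at most exponentially, so it vanishes
  identically once it vanishes at \<open>T\<close>. The feedback term of the drift enters it only through
  \<open>- 2 Dy \<bullet> M U y + tr D (U y \<bullet> M U y)\<close>, which is at least \<open>- Dy \<bullet> M D y / tr D\<close> by completing the
  square, and that is absorbed by the form itself.\<close>

lemma psd_imp_pd_of_observable:
  fixes A M :: "real^'n^'n" and C :: "real^'n^'m" and D D' U :: "real \<Rightarrow> real^'n^'n"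
  assumes obs: "observable A C" and \<alpha>: "\<alpha> > 0" and T: "T > 0" and M: "M \<in> psd_cone"
    and der: "\<And>s. s \<in> {0..T} \<Longrightarrow> (D has_vector_derivative D' s) (at s within {0..T})"
    and psd: "\<And>s. s \<in> {0..T} \<Longrightarrow> D s \<in> psd_cone"
    and trpos: "\<And>s. s \<in> {0..T} \<Longrightarrow> 0 < trace (D s)"
    and drift: "\<And>s x. s \<in> {0..T} \<Longrightarrow>
      2 * ((D s *v x) \<bullet> (\<alpha> *\<^sub>R (A *v x) - M *v (U s *v x))) +
      trace (D s) * (\<alpha>\<^sup>2 * ((C *v x) \<bullet> (C *v x)) + (U s *v x) \<bullet> (M *v (U s *v x)))
      \<le> x \<bullet> (D' s *v x)"
  shows "D T \<in> pd_matrices"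
proof -
  have T0: "T \<in> {0..T}" using T by simp
  have "0 < x \<bullet> (D T *v x)" if "x \<noteq> 0" for x
  proof (rule ccontr)
    assume "\<not> ?thesis"
    then have xT: "x \<bullet> (D T *v x) = 0" using psd_coneD(2)[OF psd[OF T0], of x] by simp
    \<comment> \<open>The rate \<open>- \<alpha>\<close> makes the motion of \<open>y\<close> cancel
      the term of the drift that contains \<open>A\<close>.\<close>
    obtain y where yT: "y T = x" and
      y: "\<And>s. s \<in> {0..T} \<Longrightarrow> (y has_vector_derivative (- \<alpha>) *\<^sub>R (A *v y s)) (at s within {0..T})"
      using linear_ode_terminal_value[of T x "- \<alpha>" A] T by auto
    define \<phi> where "\<phi> = (\<lambda>s. y s \<bullet> (D s *v y s))"
    define \<phi>' where "\<phi>' = (\<lambda>s. y s \<bullet> (D' s *v y s) - 2 * \<alpha> * ((D s *v y s) \<bullet> (A *v y s)))"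
    have d\<phi>: "(\<phi> has_vector_derivative \<phi>' s) (at s within {0..T})" if s: "s \<in> {0..T}" for s
    proof -
      note Dy = bounded_bilinear.has_vector_derivative[OF bounded_bilinear_matrix_vector_mult
          der[OF s] y[OF s]]
      have "y s \<bullet> (D s *v (A *v y s)) = (D s *v y s) \<bullet> (A *v y s)"
        by (rule symmetric_inner[OF psd_coneD(1)[OF psd[OF s]]])
      then have eq: "y s \<bullet> (D s *v (- \<alpha>) *\<^sub>R (A *v y s) + D' s *v y s) +
          ((- \<alpha>) *\<^sub>R (A *v y s)) \<bullet> (D s *v y s) = \<phi>' s"
        by (simp add: \<phi>'_def matrix_vector_mult_scaleR inner_add_right inner_commute
            algebra_simps del: scaleR_minus_left)
      show ?thesis
        unfolding \<phi>_def
        using bounded_bilinear.has_vector_derivative[OF bounded_bilinear_inner y[OF s] Dy]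
        unfolding eq .
    qed
    have \<phi>'_ge: "\<phi>' s \<ge> - norm M * \<phi> s + trace (D s) * \<alpha>\<^sup>2 * ((C *v y s) \<bullet> (C *v y s))"
      if s: "s \<in> {0..T}" for s
    proof -
      define d a u where "d = trace (D s)" and "a = D s *v y s" and "u = U s *v y s"
      have d: "d > 0" using trpos[OF s] by (simp add: d_def)
      have sym: "a \<bullet> (M *v u) = u \<bullet> (M *v a)"
        using symmetric_inner[OF psd_coneD(1)[OF M], of a u] by (simp add: inner_commute)
      have "0 \<le> (d *\<^sub>R u - a) \<bullet> (M *v (d *\<^sub>R u - a))" by (rule psd_coneD(2)[OF M])
      also have "\<dots> = d * (d * (u \<bullet> (M *v u)) - 2 * (a \<bullet> (M *v u))) + a \<bullet> (M *v a)"
        by (simp add: algebra_simps inner_diff_left inner_diff_right sym)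
      also have "\<dots> \<le> d * (d * (u \<bullet> (M *v u)) - 2 * (a \<bullet> (M *v u))) + norm M * (norm a)\<^sup>2"
        using abs_quadratic_form_le[of a M] by simp
      also have "\<dots> \<le> d * (d * (u \<bullet> (M *v u)) - 2 * (a \<bullet> (M *v u))) + norm M * (d * \<phi> s)"
        using psd_norm_mult_le[OF psd[OF s], of "y s"]
        by (intro add_left_mono mult_left_mono) (auto simp: d_def a_def \<phi>_def)
      also have "\<dots> = d * (d * (u \<bullet> (M *v u)) - 2 * (a \<bullet> (M *v u)) + norm M * \<phi> s)"
        by (simp add: algebra_simps)
      finally have "0 \<le> d * (u \<bullet> (M *v u)) - 2 * (a \<bullet> (M *v u)) + norm M * \<phi> s"
        using d by (simp add: zero_le_mult_iff)
      moreover have "2 * (\<alpha> * (a \<bullet> (A *v y s)) - a \<bullet> (M *v u)) +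
          d * (\<alpha>\<^sup>2 * ((C *v y s) \<bullet> (C *v y s)) + u \<bullet> (M *v u)) \<le> y s \<bullet> (D' s *v y s)"
        using drift[OF s, of "y s"] by (simp add: d_def a_def u_def inner_diff_right)
      ultimately show ?thesis
        unfolding \<phi>'_def d_def[symmetric] a_def[symmetric] by (simp add: algebra_simps)
    qed
    have \<phi>_nonneg: "0 \<le> \<phi> s" if "s \<in> {0..T}" for s
      using psd_coneD(2)[OF psd[OF that]] by (simp add: \<phi>_def)
    have \<phi>0: "\<phi> s = 0" if s: "s \<in> {0..T}" for s
    proof -
      have sub: "{s..T} \<subseteq> {0..T}" using s by auto
      have "exp (norm M * s) * \<phi> s \<le> exp (norm M * T) * \<phi> T"
      proof (rule exp_weighted_mono[where \<phi>' = \<phi>'])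
        show "s \<le> T" using s by simp
        fix r assume "r \<in> {s..T}"
        then have r: "r \<in> {0..T}" using sub by blast
        show "(\<phi> has_vector_derivative \<phi>' r) (at r within {s..T})"
          by (rule has_vector_derivative_within_subset[OF d\<phi>[OF r] sub])
        have "0 \<le> trace (D r) * \<alpha>\<^sup>2 * ((C *v y r) \<bullet> (C *v y r))"
          using trpos[OF r] by simp
        then show "- norm M * \<phi> r \<le> \<phi>' r" using \<phi>'_ge[OF r] by linarith
      qed
      also have "\<dots> = 0" by (simp add: \<phi>_def yT xT)
      finally have "exp (norm M * s) * \<phi> s \<le> 0" .
      then have "\<phi> s \<le> 0" unfolding mult_le_0_iff by (metis exp_gt_zero not_le)
      then show ?thesis using \<phi>_nonneg[OF s] by simp
    qed
    have Cy: "C *v y s = 0" if s: "s \<in> {0..T}" for s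
    proof -
      \<comment> \<open>As \<open>\<phi>\<close> vanishes identically, so does its derivative, and
        in \<open>\<phi>'_ge\<close> only the nonnegative observation term is left.\<close>
      have "(\<phi> has_vector_derivative 0) (at s within {0..T})"
        by (rule has_vector_derivative_transform[OF s _ has_vector_derivative_const[of 0]])
           (simp add: \<phi>0)
      then have "\<phi>' s = 0"
        by (rule has_vector_derivative_unique_Icc[OF T s d\<phi>[OF s]])
      then have "trace (D s) * \<alpha>\<^sup>2 * ((C *v y s) \<bullet> (C *v y s)) \<le> 0"
        using \<phi>'_ge[OF s] \<phi>0[OF s] by simp
      moreover have "0 < trace (D s) * \<alpha>\<^sup>2" using trpos[OF s] \<alpha> by simp
      ultimately have "\<not> 0 < (C *v y s) \<bullet> (C *v y s)"
        using mult_pos_pos[of "trace (D s) * \<alpha>\<^sup>2" "(C *v y s) \<bullet> (C *v y s)"] by linarith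
      then show ?thesis by simp
    qed
    have "x = 0"
      using observable_trajectory_eq_0[OF obs _ T y Cy T0] \<alpha> yT by simp
    then show False using that by simp
  qed
  then show ?thesis
    using psd_coneD(1)[OF psd[OF T0]] by (simp add: pd_matrices_def symmetric_matrices_def)
qed

section \<open>The Riccati field\<close>

text \<open>\<open>M\<close> stands for \<open>B ** matrix_inv R ** transpose B\<close>; from here
  on it is known only as a member of the cone.\<close>

locale riccati =
  fixes A M :: "real^'n^'n" and C :: "real^'n^'m" and \<alpha> :: real
  assumes M: "M \<in> psd_cone" and \<alpha>: "\<alpha> > 0"
begin

definition lin :: "real^'n^'n \<Rightarrow> real^'n^'n" where
  "lin P = \<alpha> *\<^sub>R (transpose A ** P) + \<alpha> *\<^sub>R (P ** A) + (\<alpha>\<^sup>2 * trace P) *\<^sub>R (transpose C ** C)"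

text \<open>Division is total, so the formula already takes the prescribed value \<open>0\<close> at
  \<open>P = 0\<close> and no case distinction has to be carried along.\<close>

definition field :: "real^'n^'n \<Rightarrow> real^'n^'n" where
  "field P = lin P - (1 / trace P) *\<^sub>R (P ** M ** P)"

lemma lin_0: "lin 0 = 0"
  by (simp add: lin_def trace_def)

lemma field_0: "field 0 = 0"
  by (simp add: field_def lin_0)

text \<open>The feedback term is quadratic over linear, hence odd like the rest. This carries
  results for positive trace over to negative trace in \<open>solution_from_zero\<close>.\<close>

lemma field_minus: "field (- P) = - field P"
  unfolding field_def lin_def
  by (simp add: matrix_mult.minus_left matrix_mult.minus_right trace_def sum_negf algebra_simps)

lemma field_quadratic_form:
  assumes "transpose P = P"
  shows "x \<bullet> (field P *v x) = 2 * \<alpha> * ((P *v x) \<bullet> (A *v x)) -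
    (1 / trace P) * ((P *v x) \<bullet> (M *v (P *v x))) + \<alpha>\<^sup>2 * trace P * ((C *v x) \<bullet> (C *v x))"
proof -
  have "x \<bullet> ((transpose A ** P) *v x) = (P *v x) \<bullet> (A *v x)"
    using inner_transpose_mult[of x A "P *v x"]
    by (simp add: matrix_vector_mul_assoc[symmetric] inner_commute del: transpose_matrix_vector)
  moreover have "x \<bullet> ((P ** A) *v x) = (P *v x) \<bullet> (A *v x)"
    using symmetric_inner[OF assms] by (simp add: matrix_vector_mul_assoc[symmetric])
  moreover have "x \<bullet> ((P ** M ** P) *v x) = (P *v x) \<bullet> (M *v (P *v x))"
    using symmetric_inner[OF assms] by (simp add: matrix_vector_mul_assoc[symmetric])
  moreover have "x \<bullet> ((transpose C ** C) *v x) = (C *v x) \<bullet> (C *v x)"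
    using inner_transpose_mult[of x C "C *v x"]
    by (simp add: matrix_vector_mul_assoc[symmetric] del: transpose_matrix_vector)
  ultimately show ?thesis
    unfolding field_def lin_def
    by (simp add: inner_add_right inner_diff_right matrix_vector_mult_add_rdistrib
        matrix_vector_mult_diff_rdistrib scaleR_matrix_vector_assoc[symmetric])
qed

text \<open>\<open>gain U\<close> and \<open>source U\<close> are the functions \<open>l\<close> and
  \<open>v\<close> in the drift hypotheses of \<open>psd_invariant\<close> and
  \<open>trace_exp_lower_bound\<close>.\<close>

definition gain :: "real^'n^'n \<Rightarrow> real^'n \<Rightarrow> real^'n" where
  "gain U x = \<alpha> *\<^sub>R (A *v x) - M *v (U *v x)"

definition source :: "real^'n^'n \<Rightarrow> real^'n \<Rightarrow> real" where
  "source U x = \<alpha>\<^sup>2 * ((C *v x) \<bullet> (C *v x)) + (U *v x) \<bullet> (M *v (U *v x))"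

text \<open>\<open>P M P / tr P\<close> is the perspective of a convex function, hence lies above its linearization
  at \<open>Q\<close>. Expanding around \<open>Q\<close> rather than around \<open>P\<close> gives the remainder the right sign.\<close>

lemma drift_difference:
  fixes P Q :: "real^'n^'n"
  assumes Q: "transpose Q = Q" "0 < trace Q"
    and P: "transpose P = P" "P = 0 \<or> 0 < trace P"
  defines "U \<equiv> (1 / trace Q) *\<^sub>R Q"
  shows "2 * (((Q - P) *v x) \<bullet> gain U x) + trace (Q - P) * source U x
    \<le> x \<bullet> ((field Q - field P) *v x)"
proof -
  define q p a b u where "q = trace Q" and "p = trace P" and "a = Q *v x" and "b = P *v x"
    and "u = U *v x"
  have q: "q > 0" using Q by (simp add: q_def)
  have a: "a = q *\<^sub>R u"
    using q by (simp add: a_def u_def U_def q_def scaleR_matrix_vector_assoc[symmetric])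
  have sym: "b \<bullet> (M *v u) = u \<bullet> (M *v b)"
    using symmetric_inner[OF psd_coneD(1)[OF M], of b u] by (simp add: inner_commute)
  \<comment> \<open>The square of \<open>b - p *\<^sub>R u\<close> in the form \<open>M\<close>,
    divided by \<open>p\<close>. For \<open>P = 0\<close> both sides are \<open>0\<close>, which
    admits the zero solution to the comparison.\<close>
  have rem: "(1 / p) * (b \<bullet> (M *v b)) \<ge> 2 * (b \<bullet> (M *v u)) - p * (u \<bullet> (M *v u))"
  proof (cases "P = 0")
    case True
    then show ?thesis by (simp add: p_def b_def trace_def)
  next
    case False
    then have p: "p > 0" using P by (simp add: p_def)
    have "0 \<le> (b - p *\<^sub>R u) \<bullet> (M *v (b - p *\<^sub>R u))" by (rule psd_coneD(2)[OF M])
    also have "\<dots> = b \<bullet> (M *v b) - p * (2 * (b \<bullet> (M *v u)) - p * (u \<bullet> (M *v u)))"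
      by (simp add: algebra_simps inner_diff_left inner_diff_right sym)
    finally show ?thesis using p by (simp add: field_simps)
  qed
  have quad: "x \<bullet> ((field Q - field P) *v x) =
      2 * \<alpha> * (a \<bullet> (A *v x)) - (1 / q) * (a \<bullet> (M *v a)) + \<alpha>\<^sup>2 * q * ((C *v x) \<bullet> (C *v x))
    - (2 * \<alpha> * (b \<bullet> (A *v x)) - (1 / p) * (b \<bullet> (M *v b)) + \<alpha>\<^sup>2 * p * ((C *v x) \<bullet> (C *v x)))"
    using field_quadratic_form[OF Q(1), of x] field_quadratic_form[OF P(1), of x]
    by (simp add: matrix_vector_mult_diff_rdistrib inner_diff_right a_def b_def p_def q_def)
  have feedback: "(1 / q) * (a \<bullet> (M *v a)) = q * (u \<bullet> (M *v u))"
    using q by (simp add: a matrix_vector_mult_scaleR)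
  have gain: "((Q - P) *v x) \<bullet> gain U x =
      \<alpha> * (a \<bullet> (A *v x)) - \<alpha> * (b \<bullet> (A *v x)) - q * (u \<bullet> (M *v u)) + b \<bullet> (M *v u)"
    by (simp add: gain_def matrix_vector_mult_diff_rdistrib inner_diff_left inner_diff_right
        a_def[symmetric] b_def[symmetric] u_def[symmetric])
       (simp add: a algebra_simps)
  have tr: "trace (Q - P) = q - p" by (simp add: q_def p_def trace_sub)
  have source: "source U x = \<alpha>\<^sup>2 * ((C *v x) \<bullet> (C *v x)) + u \<bullet> (M *v u)"
    by (simp add: source_def u_def)
  show ?thesis
    unfolding quad gain tr source feedback using rem by (simp add: algebra_simps)
qed

text \<open>The first two summands bound \<open>gain\<close>, the last two bound
  \<open>source\<close>; the factors \<open>2\<close> and \<open>4\<close> come from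
  \<open>norm U \<le> 2\<close>. On the cone the normalized matrix has norm at most 1; the slack is
  for curves whose positivity is not yet known.\<close>

definition rate :: real where
  "rate = \<alpha> * norm A + 2 * norm M + \<alpha>\<^sup>2 * (norm C)\<^sup>2 + 4 * norm M"

lemma rate_nonneg: "0 \<le> rate"
  using \<alpha> by (simp add: rate_def)

lemma gain_le:
  assumes "norm U \<le> 2"
  shows "norm (gain U x) \<le> rate * norm x"
proof -
  have "norm (gain U x) \<le> \<alpha> * norm (A *v x) + norm (M *v (U *v x))"
    unfolding gain_def using norm_triangle_ineq4[of "\<alpha> *\<^sub>R (A *v x)" "M *v (U *v x)"] \<alpha> by simp
  also have "norm (A *v x) \<le> norm A * norm x" by (rule norm_matrix_vector_le)
  also have "norm (M *v (U *v x)) \<le> norm M * (2 * norm x)"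
  proof -
    have "norm (U *v x) \<le> 2 * norm x"
      using norm_matrix_vector_le[of U x] assms mult_right_mono[of "norm U" 2 "norm x"] by simp
    then show ?thesis
      using norm_matrix_vector_le[of M "U *v x"] mult_left_mono[of _ _ "norm M"]
      by (meson norm_ge_zero order_trans)
  qed
  finally have "norm (gain U x) \<le> (\<alpha> * norm A + 2 * norm M) * norm x"
    using \<alpha> by (simp add: algebra_simps)
  also have "\<dots> \<le> rate * norm x" by (intro mult_right_mono) (auto simp: rate_def)
  finally show ?thesis .
qed

lemma source_nonneg: "0 \<le> source U x"
  using psd_coneD(2)[OF M] by (simp add: source_def)

lemma source_le:
  assumes "norm U \<le> 2"
  shows "source U x \<le> rate * (norm x)\<^sup>2"
proof -
  have "norm (U *v x) \<le> 2 * norm x"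
    using norm_matrix_vector_le[of U x] assms mult_right_mono[of "norm U" 2 "norm x"] by simp
  then have "(norm (U *v x))\<^sup>2 \<le> 4 * (norm x)\<^sup>2"
    using power_mono[of "norm (U *v x)" "2 * norm x" 2] by (simp add: power_mult_distrib)
  then have "(U *v x) \<bullet> (M *v (U *v x)) \<le> norm M * (4 * (norm x)\<^sup>2)"
    using abs_quadratic_form_le[of "U *v x" M] mult_left_mono[of "(norm (U *v x))\<^sup>2" _ "norm M"]
    by (smt (verit) norm_ge_zero)
  moreover have "(C *v x) \<bullet> (C *v x) \<le> (norm C)\<^sup>2 * (norm x)\<^sup>2"
    using power_mono[OF norm_matrix_vector_le[of C x], of 2]
    by (simp add: dot_square_norm power_mult_distrib)
  then have "\<alpha>\<^sup>2 * ((C *v x) \<bullet> (C *v x)) \<le> \<alpha>\<^sup>2 * ((norm C)\<^sup>2 * (norm x)\<^sup>2)"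
    by (intro mult_left_mono) auto
  ultimately have "source U x \<le> (\<alpha>\<^sup>2 * (norm C)\<^sup>2 + 4 * norm M) * (norm x)\<^sup>2"
    by (simp add: source_def algebra_simps)
  also have "\<dots> \<le> rate * (norm x)\<^sup>2"
    using \<alpha> by (intro mult_right_mono) (auto simp: rate_def)
  finally show ?thesis .
qed

section \<open>Comparison of two solutions\<close>

text \<open>\<open>Q\<close> is restricted by its trace rather than by membership in the cone,
  because \<open>stays_psd\<close> proves that membership by applying this lemma with the zero
  solution as \<open>P\<close>.\<close>

lemma difference_psd:
  fixes P Q :: "real \<Rightarrow> real^'n^'n"
  assumes derQ: "\<And>s. s \<in> {0..T} \<Longrightarrow> (Q has_vector_derivative field (Q s)) (at s within {0..T})"
    and derP: "\<And>s. s \<in> {0..T} \<Longrightarrow> (P has_vector_derivative field (P s)) (at s within {0..T})"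
    and Q: "\<And>s. s \<in> {0..T} \<Longrightarrow> transpose (Q s) = Q s"
      "\<And>s. s \<in> {0..T} \<Longrightarrow> 0 < trace (Q s)" "\<And>s. s \<in> {0..T} \<Longrightarrow> norm (Q s) \<le> 2 * trace (Q s)"
    and P: "\<And>s. s \<in> {0..T} \<Longrightarrow> transpose (P s) = P s"
      "\<And>s. s \<in> {0..T} \<Longrightarrow> P s = 0 \<or> 0 < trace (P s)"
    and init: "Q 0 - P 0 \<in> psd_cone" and s: "s \<in> {0..T}"
  shows "Q s - P s \<in> psd_cone"
    and "trace (Q 0 - P 0) \<le> exp (2 * real CARD('n) * rate * s) * trace (Q s - P s)"
proof -
  define U where "U = (\<lambda>s. (1 / trace (Q s)) *\<^sub>R Q s)"
  have U: "norm (U s) \<le> 2" if "s \<in> {0..T}" for s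
    using Q(2,3)[OF that] by (simp add: U_def field_simps)
  note der = has_vector_derivative_diff[OF derQ derP]
  have drift: "2 * (((Q s - P s) *v x) \<bullet> gain (U s) x) + trace (Q s - P s) * source (U s) x
      \<le> x \<bullet> ((field (Q s) - field (P s)) *v x)" if "s \<in> {0..T}" for s x
    unfolding U_def using that by (intro drift_difference Q P)
  have psd: "Q s - P s \<in> psd_cone" if "s \<in> {0..T}" for s
    using psd_invariant[of T "\<lambda>s. Q s - P s", OF der _ init drift gain_le[OF U] source_nonneg
        source_le[OF U] rate_nonneg that] by (simp add: transpose_diff Q P)
  then show "Q s - P s \<in> psd_cone" using s by blast
  show "trace (Q 0 - P 0) \<le> exp (2 * real CARD('n) * rate * s) * trace (Q s - P s)"
    using trace_exp_lower_bound[of T "\<lambda>s. Q s - P s", OF der psd drift gain_le[OF U] source_nonneg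
        rate_nonneg s] by simp
qed

lemma difference_pd:
  fixes P Q :: "real \<Rightarrow> real^'n^'n"
  assumes obs: "observable A C" and T: "0 < T"
    and derQ: "\<And>s. s \<in> {0..T} \<Longrightarrow> (Q has_vector_derivative field (Q s)) (at s within {0..T})"
    and derP: "\<And>s. s \<in> {0..T} \<Longrightarrow> (P has_vector_derivative field (P s)) (at s within {0..T})"
    and Q: "\<And>s. s \<in> {0..T} \<Longrightarrow> Q s \<in> psd_cone \<and> 0 < trace (Q s)"
    and P: "\<And>s. s \<in> {0..T} \<Longrightarrow> P s = 0 \<or> P s \<in> psd_cone \<and> 0 < trace (P s)"
    and init: "Q 0 - P 0 \<in> psd_cone" "Q 0 \<noteq> P 0"
  shows "Q T - P T \<in> pd_matrices"
proof -
  have sQ: "transpose (Q s) = Q s" if "s \<in> {0..T}" for s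
    using Q[OF that] psd_coneD(1) by blast
  have sP: "transpose (P s) = P s" if "s \<in> {0..T}" for s
    using P[OF that] psd_coneD(1) by (auto simp: transpose_def vec_eq_iff)
  have nQ: "norm (Q s) \<le> 2 * trace (Q s)" if "s \<in> {0..T}" for s
    using Q[OF that] psd_norm_le_trace[of "Q s"] by linarith
  have P': "P s = 0 \<or> 0 < trace (P s)" if "s \<in> {0..T}" for s
    using P[OF that] by blast
  note diff = difference_psd[OF derQ derP sQ _ nQ sP P' init(1)]
  have tr: "0 < trace (Q s - P s)" if s: "s \<in> {0..T}" for s
  proof -
    have "0 < trace (Q 0 - P 0)" using psd_trace_pos[OF init(1)] init(2) by simp
    also have "\<dots> \<le> exp (2 * real CARD('n) * rate * s) * trace (Q s - P s)"
      using diff(2)[OF _ _ _ _ _ _ _ s] Q by blast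
    finally show ?thesis by (simp add: zero_less_mult_iff)
  qed
  show ?thesis
  proof (rule psd_imp_pd_of_observable[OF obs \<alpha> T M, of "\<lambda>s. Q s - P s"])
    fix s assume s: "s \<in> {0..T}"
    show "((\<lambda>s. Q s - P s) has_vector_derivative field (Q s) - field (P s)) (at s within {0..T})"
      by (intro has_vector_derivative_diff derQ derP s)
    show "Q s - P s \<in> psd_cone" using diff(1)[OF _ _ _ _ _ _ _ s] Q by blast
    show "0 < trace (Q s - P s)" by (rule tr[OF s])
    fix x
    show "2 * (((Q s - P s) *v x) \<bullet> (\<alpha> *\<^sub>R (A *v x) - M *v (((1 / trace (Q s)) *\<^sub>R Q s) *v x))) +
      trace (Q s - P s) * (\<alpha>\<^sup>2 * ((C *v x) \<bullet> (C *v x)) +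
        (((1 / trace (Q s)) *\<^sub>R Q s) *v x) \<bullet> (M *v (((1 / trace (Q s)) *\<^sub>R Q s) *v x)))
      \<le> x \<bullet> ((field (Q s) - field (P s)) *v x)"
      using drift_difference[OF sQ[OF s] _ sP[OF s] P'[OF s], of x] Q[OF s]
      by (simp only: gain_def source_def)
  qed
qed

text \<open>A continuation argument: while \<open>norm P < 2 * trace P\<close>, comparison with the
  zero solution puts \<open>P\<close> in the cone with trace at least \<open>c\<close>. Both facts
  survive in the limit and imply the strict inequality again, so it cannot fail for a first time.
  \<open>P'\<close> is abstract so that solutions of \<open>field_ext\<close> and of
  \<open>field\<close> are both covered.\<close>

lemma stays_psd:
  fixes P P' :: "real \<Rightarrow> real^'n^'n"
  assumes der: "\<And>s. s \<in> {0..T} \<Longrightarrow> (P has_vector_derivative P' s) (at s within {0..T})"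
    and eq: "\<And>s. s \<in> {0..T} \<Longrightarrow> norm (P s) < 2 * trace (P s) \<Longrightarrow> P' s = field (P s)"
    and sym: "\<And>s. s \<in> {0..T} \<Longrightarrow> transpose (P s) = P s"
    and init: "P 0 \<in> psd_cone" "P 0 \<noteq> 0" and s: "s \<in> {0..T}"
  shows "P s \<in> psd_cone \<and> 0 < trace (P s)"
proof -
  define c where "c = (\<lambda>s. exp (- (2 * real CARD('n) * rate * s)) * trace (P 0))"
  have c: "c s > 0" for s using psd_trace_pos[OF init] by (simp add: c_def)
  have Pc: "continuous_on {0..T} P"
    using der has_vector_derivative_continuous continuous_on_eq_continuous_within by blast
  have good: "P r \<in> psd_cone \<and> c r \<le> trace (P r)"
    if r: "r \<in> {0..T}" and in_dom: "\<And>s. s \<in> {0..r} \<Longrightarrow> norm (P s) < 2 * trace (P s)" for r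
  proof -
    have sub: "{0..r} \<subseteq> {0..T}" using r by auto
    have tr: "0 < trace (P s)" if "s \<in> {0..r}" for s
      using in_dom[OF that] norm_ge_zero[of "P s"] by linarith
    have dP: "(P has_vector_derivative field (P s)) (at s within {0..r})" if "s \<in> {0..r}" for s
      using has_vector_derivative_within_subset[OF der sub] eq in_dom that sub by fastforce
    have d0: "((\<lambda>s. 0) has_vector_derivative field 0) F" for F
      by (simp add: field_0)
    have "P r - 0 \<in> psd_cone"
      by (rule difference_psd(1)[OF dP d0 sym tr less_imp_le[OF in_dom]])
         (use r init sub in \<open>auto simp: transpose_def vec_eq_iff\<close>)
    moreover have "trace (P 0 - 0) \<le> exp (2 * real CARD('n) * rate * r) * trace (P r - 0)"
      by (rule difference_psd(2)[OF dP d0 sym tr less_imp_le[OF in_dom]])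
         (use r init sub in \<open>auto simp: transpose_def vec_eq_iff\<close>)
    ultimately show ?thesis by (simp add: c_def exp_minus field_simps)
  qed
  define Z where "Z = {s \<in> {0..T}. 2 * trace (P s) \<le> norm (P s)}"
  have "Z = {}"
  proof (rule ccontr)
    assume ne: "Z \<noteq> {}"
    have trc: "continuous_on {0..T} (\<lambda>s. trace (P s))"
      by (rule bounded_linear.continuous_on[OF bounded_linear_trace Pc])
    have "closed ({0..T} \<inter> (\<lambda>s. 2 * trace (P s) - norm (P s)) -` {..0})"
      by (intro continuous_closed_preimage continuous_intros Pc trc closed_atMost)
    moreover have "{0..T} \<inter> (\<lambda>s. 2 * trace (P s) - norm (P s)) -` {..0} = Z"
      by (auto simp: Z_def)
    ultimately have "closed Z" by simp
    moreover have "bdd_below Z" by (auto simp: Z_def bdd_below_def)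
    ultimately have "Inf Z \<in> Z" using ne closed_contains_Inf by blast
    define s1 where "s1 = Inf Z"
    have s1Z: "s1 \<in> Z" unfolding s1_def by fact
    then have s1: "s1 \<in> {0..T}" and bad: "2 * trace (P s1) \<le> norm (P s1)" by (auto simp: Z_def)
    have before: "norm (P r) < 2 * trace (P r)" if "r \<in> {0..<s1}" for r
      using cInf_lower[OF _ \<open>bdd_below Z\<close>, of r] that s1 unfolding s1_def[symmetric]
      by (auto simp: Z_def not_le[symmetric])
    have "s1 \<noteq> 0"
      using bad psd_trace_pos[OF init] psd_norm_le_trace[OF init(1)] by auto
    then have pos: "0 < s1" using s1 by simp
    have cl: "closure {0..<s1} = {0..s1}" using pos by simp
    have sub: "{0..s1} \<subseteq> {0..T}" using s1 by auto
    have good': "P r \<in> psd_cone \<and> c r \<le> trace (P r)" if "r \<in> {0..<s1}" for r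
      using that s1 by (intro good before) auto
    have "P ` closure {0..<s1} \<subseteq> closure psd_cone"
      using good' unfolding cl
      by (intro image_closure_subset[of "{0..<s1}" P, unfolded cl] continuous_on_subset[OF Pc sub])
         (auto simp: closed_psd_cone)
    then have psd: "P s1 \<in> psd_cone"
      using pos closed_psd_cone unfolding cl closure_closed[OF closed_psd_cone] by force
    \<comment> \<open>Membership in the cone alone would still allow \<open>P s1 = 0\<close>; the
      positive bound \<open>c s1\<close> rules this out.\<close>
    have "0 \<le> trace (P s1) - c s1"
    proof (rule continuous_ge_on_closure[of "{0..<s1}" "\<lambda>r. trace (P r) - c r"])
      show "continuous_on (closure {0..<s1}) (\<lambda>r. trace (P r) - c r)"
        unfolding cl c_def by (intro continuous_intros continuous_on_subset[OF trc sub])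
    qed (use cl pos good' in auto)
    then show False
      using bad psd_norm_le_trace[OF psd] c[of s1] by linarith
  qed
  then have "norm (P r) < 2 * trace (P r)" if "r \<in> {0..T}" for r
    using that by (auto simp: Z_def not_le[symmetric])
  then have "P s \<in> psd_cone \<and> c s \<le> trace (P s)" using s by (intro good) auto
  then show ?thesis using c[of s] by linarith
qed

section \<open>Existence and uniqueness of solutions\<close>

text \<open>Near the nonzero part of the cone \<open>reg P = tr P\<close>. As \<open>reg P \<ge> \<parallel>P\<parallel> / 2\<close> everywhere,
  the field with \<open>tr P\<close> replaced by \<open>reg P\<close> is globally Lipschitz, although it is only
  homogeneous of degree one and not smooth at \<open>0\<close>.\<close>

definition reg :: "real^'n^'n \<Rightarrow> real" where
  "reg P = max (trace P) (norm P / 2)"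

definition field_ext :: "real^'n^'n \<Rightarrow> real^'n^'n" where
  "field_ext P = lin P - P ** M ** ((1 / reg P) *\<^sub>R P)"

lemma field_ext_eq: "norm P < 2 * trace P \<Longrightarrow> field_ext P = field P"
  by (simp add: field_ext_def field_def reg_def max_def matrix_mult.scaleR_right)

lemma bounded_linear_lin: "bounded_linear lin"
  unfolding lin_def
  by (intro bounded_linear_add bounded_linear_scaleR_left[THEN bounded_linear_compose]
      bounded_linear_compose[OF bounded_linear_scaleR_right]
      matrix_mult.bounded_linear_left matrix_mult.bounded_linear_right
      bounded_linear_compose[OF bounded_linear_mult_right] bounded_linear_trace)

lemma reg_lipschitz:
  obtains K where "0 \<le> K" "\<And>P Q. \<bar>reg P - reg Q\<bar> \<le> K * norm (P - Q)"
proof -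
  obtain K where K: "0 \<le> K" "\<And>P :: real^'n^'n. norm (trace P) \<le> norm P * K"
    using bounded_linear.nonneg_bounded[OF bounded_linear_trace] by blast
  have "\<bar>reg P - reg Q\<bar> \<le> (K + 1) * norm (P - Q)" for P Q
  proof -
    have "\<bar>trace P - trace Q\<bar> \<le> K * norm (P - Q)"
      using K(2)[of "P - Q"] by (simp add: trace_sub mult.commute)
    moreover have "\<bar>norm P / 2 - norm Q / 2\<bar> \<le> norm (P - Q)"
      using norm_triangle_ineq3[of P Q] by linarith
    moreover have "0 \<le> K * norm (P - Q)" using K(1) by simp
    ultimately show ?thesis
      unfolding reg_def distrib_right max_def using norm_ge_zero[of "P - Q"] by (simp; linarith)
  qed
  then show ?thesis using that[of "K + 1"] K(1) by simp
qed

text \<open>With \<open>S P\<close> the normalized matrix, the feedback difference splits into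
  \<open>(P - Q) ** M ** S P\<close> and \<open>Q ** M ** (S P - S Q)\<close>. \<open>S\<close> is
  bounded by 2 but discontinuous at \<open>0\<close>; the weight \<open>norm Q\<close> makes up for
  that, since it is at most \<open>2 * reg Q\<close>.\<close>

lemma field_ext_lipschitz:
  obtains K where "\<And>P Q. norm (field_ext P - field_ext Q) \<le> K * norm (P - Q)"
proof -
  obtain Kl where Kl: "\<And>P. norm (lin P) \<le> norm P * Kl"
    using bounded_linear.nonneg_bounded[OF bounded_linear_lin] by blast
  obtain Kr where Kr: "0 \<le> Kr" "\<And>P Q. \<bar>reg P - reg Q\<bar> \<le> Kr * norm (P - Q)"
    using reg_lipschitz by blast
  define S where "S = (\<lambda>P :: real^'n^'n. (1 / reg P) *\<^sub>R P)"
  have reg_ge: "norm P / 2 \<le> reg P" for P by (simp add: reg_def)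
  have S2: "norm (S P) \<le> 2" for P
  proof (cases "P = 0")
    case False
    then have "0 < norm P" by simp
    then have "0 < reg P" using reg_ge[of P] by linarith
    then show ?thesis using reg_ge[of P] by (simp add: S_def field_simps)
  qed (simp add: S_def)
  have Sdiff: "norm Q * norm (S P - S Q) \<le> (2 + 4 * Kr) * norm (P - Q)" for P Q
  proof (cases "P = 0 \<or> Q = 0")
    case True
    have "norm Q * norm (S P - S Q) \<le> norm (P - Q) * 2"
    proof (cases "Q = 0")
      case False
      then have "P = 0" using True by blast
      then have "norm Q * norm (S P - S Q) = norm (P - Q) * norm (S Q)" by (simp add: S_def)
      also have "\<dots> \<le> norm (P - Q) * 2" by (intro mult_left_mono S2) simp
      finally show ?thesis .
    qed simp
    also have "\<dots> \<le> (2 + 4 * Kr) * norm (P - Q)" using Kr(1) by (simp add: algebra_simps)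
    finally show ?thesis .
  next
    case False
    define p q where "p = reg P" and "q = reg Q"
    have "0 < norm P" "0 < norm Q" using False by auto
    then have p: "p > 0" and q: "q > 0"
      using reg_ge[of P] reg_ge[of Q] unfolding p_def q_def by linarith+
    \<comment> \<open>Arranged so that \<open>q\<close> is the only explicit denominator:
      \<open>norm Q\<close> pays for it, and the bounded \<open>S P\<close> absorbs
      \<open>1 / p\<close>.\<close>
    have "S P - S Q = (1 / q) *\<^sub>R (P - Q) + ((q - p) / q) *\<^sub>R S P"
    proof -
      have "1 / p = 1 / q + (q - p) / q * (1 / p)" using p q by (simp add: field_simps)
      then have "(1 / p) *\<^sub>R P = (1 / q) *\<^sub>R P + ((q - p) / q * (1 / p)) *\<^sub>R P"
        by (metis scaleR_add_left)
      then have "S P = (1 / q) *\<^sub>R P + ((q - p) / q) *\<^sub>R S P"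
        unfolding S_def p_def[symmetric] scaleR_scaleR .
      moreover have "S Q = (1 / q) *\<^sub>R Q" by (simp add: S_def q_def)
      ultimately show ?thesis by (simp add: scaleR_diff_right)
    qed
    then have "norm (S P - S Q) \<le> (1 / q) * norm (P - Q) + (\<bar>q - p\<bar> / q) * norm (S P)"
      using norm_triangle_ineq[of "(1 / q) *\<^sub>R (P - Q)" "((q - p) / q) *\<^sub>R S P"] q by simp
    also have "\<dots> \<le> (1 / q) * norm (P - Q) + (\<bar>q - p\<bar> / q) * 2"
      using S2[of P] q by (intro add_left_mono mult_left_mono) auto
    also have "\<dots> = (norm (P - Q) + 2 * \<bar>q - p\<bar>) / q" by (simp add: add_divide_distrib)
    also have "\<dots> \<le> (norm (P - Q) + 2 * (Kr * norm (P - Q))) / q"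
      using Kr(2)[of Q P] q
      by (intro divide_right_mono add_left_mono mult_left_mono)
         (auto simp: p_def q_def norm_minus_commute)
    finally have "norm Q * norm (S P - S Q) \<le> norm Q * ((1 + 2 * Kr) * norm (P - Q) / q)"
      by (intro mult_left_mono) (auto simp: algebra_simps)
    also have "\<dots> = (norm Q / q) * ((1 + 2 * Kr) * norm (P - Q))" by simp
    also have "\<dots> \<le> 2 * ((1 + 2 * Kr) * norm (P - Q))"
      using reg_ge[of Q] q Kr(1) by (intro mult_right_mono) (auto simp: q_def field_simps)
    finally show ?thesis by (simp add: algebra_simps)
  qed
  have "norm (field_ext P - field_ext Q) \<le> (Kl + norm M * 2 + norm M * (2 + 4 * Kr)) * norm (P - Q)"
    for P Q
  proof -
    have "field_ext P = lin P - P ** M ** S P" for P by (simp add: field_ext_def S_def)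
    then have "field_ext P - field_ext Q = lin (P - Q) - ((P - Q) ** M ** S P + Q ** M ** (S P - S Q))"
      unfolding linear_diff[OF bounded_linear.linear[OF bounded_linear_lin]]
      by (simp add: matrix_mult.diff_left matrix_mult.diff_right)
    then have "norm (field_ext P - field_ext Q) \<le>
        norm (lin (P - Q)) + (norm ((P - Q) ** M ** S P) + norm (Q ** M ** (S P - S Q)))"
      using norm_triangle_ineq4 norm_triangle_ineq by (smt (verit))
    also have "norm (lin (P - Q)) \<le> Kl * norm (P - Q)" using Kl[of "P - Q"] by (simp add: mult.commute)
    also have "norm ((P - Q) ** M ** S P) \<le> norm (P - Q) * norm M * 2"
      by (intro order_trans[OF norm_matrix_mult_le] mult_mono norm_matrix_mult_le S2) auto
    also have "norm (Q ** M ** (S P - S Q)) \<le> (norm Q * norm M) * norm (S P - S Q)"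
      by (intro order_trans[OF norm_matrix_mult_le] mult_right_mono norm_matrix_mult_le) auto
    also have "\<dots> = norm M * (norm Q * norm (S P - S Q))" by simp
    also have "\<dots> \<le> norm M * ((2 + 4 * Kr) * norm (P - Q))"
      by (intro mult_left_mono Sdiff) auto
    finally show ?thesis by (simp add: algebra_simps)
  qed
  then show ?thesis using that by blast
qed

text \<open>By this equivariance the transpose of a solution is again a solution, so uniqueness
  makes solutions with symmetric initial value symmetric.\<close>

lemma field_ext_transpose: "field_ext (transpose P) = transpose (field_ext P)"
proof -
  have "reg (transpose P) = reg P" by (simp add: reg_def trace_transpose norm_transpose)
  moreover have "transpose M = M" by (rule psd_coneD(1)[OF M])
  ultimately show ?thesis
    by (simp add: field_ext_def lin_def transpose_add transpose_diff transpose_scaleR trace_transpose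
        matrix_transpose_mul matrix_mult.scaleR_left matrix_mult.scaleR_right matrix_mul_assoc
        add.commute)
qed

lemma solution_exists:
  assumes P0: "P0 \<in> psd_cone" "P0 \<noteq> 0" and T: "0 \<le> T"
  obtains P where "P 0 = P0"
    "\<And>s. s \<in> {0..T} \<Longrightarrow> (P has_vector_derivative field (P s)) (at s within {0..T})"
    "\<And>s. s \<in> {0..T} \<Longrightarrow> P s \<in> psd_cone" "\<And>s. s \<in> {0..T} \<Longrightarrow> 0 < trace (P s)"
proof -
  obtain K where lip: "\<And>P Q. norm (field_ext P - field_ext Q) \<le> K * norm (P - Q)"
    using field_ext_lipschitz by blast
  obtain P where init: "P 0 = P0" and
    P: "\<And>s. s \<in> {0..T} \<Longrightarrow> (P has_vector_derivative field_ext (P s)) (at s within {0..T})"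
    using lipschitz_ode_exists[OF lip T, of P0] by blast
  have sym: "transpose (P s) = P s" if s: "s \<in> {0..T}" for s
  proof (rule lipschitz_ode_unique[OF lip _ P _ s])
    show "((\<lambda>s. transpose (P s)) has_vector_derivative field_ext (transpose (P s))) (at s within {0..T})"
      if "s \<in> {0..T}" for s
      using bounded_linear.has_vector_derivative[OF bounded_linear_transpose P[OF that]]
      by (simp add: field_ext_transpose)
    show "transpose (P 0) = P 0" using init psd_coneD(1)[OF P0(1)] by simp
  qed
  have psd: "P s \<in> psd_cone \<and> 0 < trace (P s)" if "s \<in> {0..T}" for s
    by (rule stays_psd[OF P field_ext_eq sym _ _ that]) (use init P0 in auto)
  show ?thesis
  proof (rule that[of P])
    show "P 0 = P0" by fact
    fix s assume s: "s \<in> {0..T}"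
    show "P s \<in> psd_cone" "0 < trace (P s)" using psd[OF s] by auto
    have "norm (P s) < 2 * trace (P s)"
      using psd[OF s] psd_norm_le_trace[of "P s"] by linarith
    then show "(P has_vector_derivative field (P s)) (at s within {0..T})"
      using P[OF s] field_ext_eq by simp
  qed
qed

text \<open>\<open>stays_psd\<close> places both curves where \<open>field\<close> and
  \<open>field_ext\<close> agree, and there the Lipschitz uniqueness applies.\<close>

lemma solution_unique:
  assumes P0: "P0 \<in> psd_cone" "P0 \<noteq> 0"
    and P: "P 0 = P0" "\<And>s. s \<in> {0..T} \<Longrightarrow> (P has_vector_derivative field (P s)) (at s within {0..T})"
      "\<And>s. s \<in> {0..T} \<Longrightarrow> transpose (P s) = P s"
    and Q: "Q 0 = P0" "\<And>s. s \<in> {0..T} \<Longrightarrow> (Q has_vector_derivative field (Q s)) (at s within {0..T})"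
      "\<And>s. s \<in> {0..T} \<Longrightarrow> transpose (Q s) = Q s"
    and s: "s \<in> {0..T}"
  shows "P s = Q s"
proof -
  obtain K where lip: "\<And>P Q. norm (field_ext P - field_ext Q) \<le> K * norm (P - Q)"
    using field_ext_lipschitz by blast
  have ext: "(X has_vector_derivative field_ext (X s)) (at s within {0..T})"
    if X: "X 0 = P0" "\<And>s. s \<in> {0..T} \<Longrightarrow> (X has_vector_derivative field (X s)) (at s within {0..T})"
      "\<And>s. s \<in> {0..T} \<Longrightarrow> transpose (X s) = X s" and s: "s \<in> {0..T}" for X s
  proof -
    have "X s \<in> psd_cone \<and> 0 < trace (X s)"
      by (rule stays_psd[OF X(2) refl X(3) _ _ s]) (use X(1) P0 in auto)
    then have "norm (X s) < 2 * trace (X s)" using psd_norm_le_trace[of "X s"] by linarith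
    then show ?thesis using X(2)[OF s] field_ext_eq by simp
  qed
  show ?thesis
    using lipschitz_ode_unique[where F = field_ext and x = P and y = Q, OF lip ext[OF P] ext[OF Q] _ s]
      P(1) Q(1) by simp
qed

section \<open>Solutions starting at the singular point\<close>

text \<open>The congruence is positive semidefinite even for indefinite \<open>P\<close>, as
  required for a curve leaving \<open>0\<close> whose position relative to the cone is
  unknown.\<close>

lemma psd_norm_congruence_le:
  assumes "transpose P = P"
  shows "norm (P ** M ** P) \<le> trace (P ** M ** P)"
proof (rule psd_norm_le_trace)
  have "x \<bullet> ((P ** M ** P) *v x) = (P *v x) \<bullet> (M *v (P *v x))" for x
    using symmetric_inner[OF assms] by (simp add: matrix_vector_mul_assoc[symmetric])
  then show "P ** M ** P \<in> psd_cone"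
    using psd_coneD[OF M] assms
    by (simp add: psd_cone_def symmetric_matrices_def matrix_transpose_mul matrix_mul_assoc)
qed

text \<open>The field is singular at \<open>0\<close>, but a singular part \<open>P M P / tr P\<close> of the velocity is matched
  by a loss of trace, so \<open>P\<close> cannot leave \<open>0\<close> with \<open>tr P > 0\<close>.\<close>

lemma norm_le_from_zero:
  assumes "a < b" and Pc: "continuous_on {a..b} P" and "P a = 0"
    and der: "\<And>s. a < s \<Longrightarrow> s < b \<Longrightarrow> (P has_vector_derivative field (P s)) (at s)"
    and sym: "\<And>s. a < s \<Longrightarrow> s < b \<Longrightarrow> transpose (P s) = P s"
    and pos: "\<And>s. a < s \<Longrightarrow> s \<le> b \<Longrightarrow> 0 < trace (P s)"
    and K: "\<And>X. norm (lin X) \<le> norm X * K" "\<And>X :: real^'n^'n. norm (trace X) \<le> norm X * Kt"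
      "0 \<le> K" "0 \<le> Kt"
    and m: "\<And>s. a < s \<Longrightarrow> s < b \<Longrightarrow> norm (P s) \<le> m"
  shows "norm (P b) \<le> (K + K * Kt) * m * (b - a)"
proof -
  \<comment> \<open>The singular part \<open>w\<close> has norm at most
    \<open>trace w = trace (lin (P s)) - trace (field (P s))\<close>. Subtracting the trace in
    \<open>\<phi>\<close> integrates the last term exactly, and the linear term pays for the two
    bounded contributions of \<open>lin\<close>.\<close>
  define \<phi> where "\<phi> = (\<lambda>s. (K + K * Kt) * m * s - trace (P s))"
  have trc: "continuous_on {a..b} (\<lambda>s. trace (P s))"
    by (rule bounded_linear.continuous_on[OF bounded_linear_trace Pc])
  have "norm (P b - P a) \<le> \<phi> b - \<phi> a"
  proof (rule differentiable_bound_general[where f' = "\<lambda>s. field (P s)"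
        and \<phi>' = "\<lambda>s. (K + K * Kt) * m - trace (field (P s))"])
    show "continuous_on {a..b} \<phi>" unfolding \<phi>_def by (intro continuous_intros trc)
    fix s assume s: "a < s" "s < b"
    show "(P has_vector_derivative field (P s)) (at s)" by (rule der[OF s])
    show "(\<phi> has_vector_derivative (K + K * Kt) * m - trace (field (P s))) (at s)"
    proof -
      have "((\<lambda>s. trace (P s)) has_real_derivative trace (field (P s))) (at s)"
        using bounded_linear.has_vector_derivative[OF bounded_linear_trace der[OF s]]
        by (simp add: has_real_derivative_iff_has_vector_derivative)
      then show ?thesis
        unfolding \<phi>_def has_real_derivative_iff_has_vector_derivative[symmetric]
        by (auto intro!: derivative_eq_intros)
    qed
    define w where "w = (1 / trace (P s)) *\<^sub>R (P s ** M ** P s)"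
    have f: "field (P s) = lin (P s) - w" by (simp add: field_def w_def)
    have w: "norm w \<le> trace w"
      using psd_norm_congruence_le[OF sym[OF s]] pos[of s] s
      by (simp add: w_def trace_scaleR divide_right_mono)
    have lm: "norm (lin (P s)) \<le> K * m"
    proof -
      have "norm (lin (P s)) \<le> norm (P s) * K" by (rule K(1))
      also have "\<dots> \<le> m * K" by (intro mult_right_mono m s K(3))
      finally show ?thesis by (simp add: mult.commute)
    qed
    have "trace (lin (P s)) \<le> norm (lin (P s)) * Kt" using K(2)[of "lin (P s)"] by simp
    also have "\<dots> \<le> K * m * Kt" by (intro mult_right_mono lm K(4))
    finally have tl: "trace (lin (P s)) \<le> K * m * Kt" .
    have "norm (field (P s)) \<le> norm (lin (P s)) + norm w"
      unfolding f by (rule norm_triangle_ineq4)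
    also have "\<dots> \<le> K * m + trace w" using lm w by linarith
    also have "\<dots> = K * m + trace (lin (P s)) - trace (field (P s))"
      by (simp add: f trace_sub)
    also have "\<dots> \<le> (K + K * Kt) * m - trace (field (P s))"
      using tl by (simp add: algebra_simps)
    finally show "norm (field (P s)) \<le> (K + K * Kt) * m - trace (field (P s))" .
  qed (use assms in auto)
  moreover have "trace (P a) = 0" using \<open>P a = 0\<close> by (simp add: trace_def)
  ultimately have "norm (P b) \<le> (K + K * Kt) * m * (b - a) - trace (P b)"
    using \<open>P a = 0\<close> by (simp add: \<phi>_def right_diff_distrib)
  then show ?thesis using pos[of b] \<open>a < b\<close> by simp
qed

text \<open>After the last zero \<open>a\<close> the trace has a constant sign. At a point
  \<open>c\<close> of maximal norm on a short interval starting at \<open>a\<close>,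
  \<open>norm_le_from_zero\<close> bounds that maximum by a fraction of itself.\<close>

lemma solution_from_zero:
  assumes P: "P 0 = 0" "\<And>s. s \<in> {0..T} \<Longrightarrow> (P has_vector_derivative field (P s)) (at s within {0..T})"
      "\<And>s. s \<in> {0..T} \<Longrightarrow> transpose (P s) = P s"
      "\<And>s. s \<in> {0..T} \<Longrightarrow> P s = 0 \<or> trace (P s) \<noteq> 0"
    and t: "t \<in> {0..T}"
  shows "P t = 0"
proof (rule ccontr)
  assume Pt: "P t \<noteq> 0"
  have Pc: "continuous_on {0..T} P"
    using P(2) has_vector_derivative_continuous continuous_on_eq_continuous_within by blast
  obtain K where K: "0 \<le> K" "\<And>X. norm (lin X) \<le> norm X * K"
    using bounded_linear.nonneg_bounded[OF bounded_linear_lin] by blast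
  obtain Kt where Kt: "0 \<le> Kt" "\<And>X :: real^'n^'n. norm (trace X) \<le> norm X * Kt"
    using bounded_linear.nonneg_bounded[OF bounded_linear_trace] by blast
  define L where "L = K + K * Kt"
  have L: "L \<ge> 0" using K(1) Kt(1) by (simp add: L_def)
  define Z where "Z = {s \<in> {0..t}. P s = 0}"
  have sub: "{0..t} \<subseteq> {0..T}" using t by auto
  have "closed ({0..t} \<inter> P -` {0})"
    by (intro continuous_closed_preimage continuous_on_subset[OF Pc sub]) auto
  moreover have "{0..t} \<inter> P -` {0} = Z" by (auto simp: Z_def)
  ultimately have "closed Z" by simp
  moreover have "Z \<noteq> {}" using P(1) t by (auto simp: Z_def)
  moreover have bdd: "bdd_above Z" by (auto simp: Z_def bdd_above_def)
  ultimately have "Sup Z \<in> Z" by (intro closed_contains_Sup)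
  define a where "a = Sup Z"
  have aZ: "a \<in> Z" unfolding a_def by fact
  then have a: "0 \<le> a" "a \<le> t" "P a = 0" by (auto simp: Z_def)
  then have "a < t" using Pt by (cases "a = t") auto
  have nz: "P s \<noteq> 0" if "a < s" "s \<le> t" for s
    using cSup_upper[OF _ bdd, of s] that a unfolding a_def[symmetric] by (auto simp: Z_def)
  \<comment> \<open>The length makes \<open>L * (b - a)\<close> less than 1; the added 1 covers
    \<open>L = 0\<close>.\<close>
  define b where "b = min t (a + 1 / (2 * (L + 1)))"
  have b: "a < b" "b \<le> t" "b - a \<le> 1 / (2 * (L + 1))"
    using \<open>a < t\<close> L by (auto simp: b_def)
  have subab: "{a..b} \<subseteq> {0..T}" using a b t by auto
  have "continuous_on {a..b} (\<lambda>s. norm (P s))"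
    by (intro continuous_intros continuous_on_subset[OF Pc subab])
  then obtain c where c: "c \<in> {a..b}" and max: "\<And>s. s \<in> {a..b} \<Longrightarrow> norm (P s) \<le> norm (P c)"
    using continuous_attains_sup[of "{a..b}" "\<lambda>s. norm (P s)"] b by auto
  have "P b \<noteq> 0" using nz b by blast
  then have "0 < norm (P c)" using max[of b] b by (smt (verit) atLeastAtMost_iff zero_less_norm_iff)
  then have "a < c" using a(3) c by (cases "a = c") auto
  have subac: "{a..c} \<subseteq> {0..T}" using subab c by auto
  have trc: "continuous_on {a..c} (\<lambda>s. trace (P s))"
    by (rule bounded_linear.continuous_on[OF bounded_linear_trace continuous_on_subset[OF Pc subac]])
  have tnz: "trace (P s) \<noteq> 0" if "a < s" "s \<le> c" for s
    using P(4)[of s] nz[of s] that subac b c by auto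
  have at: "at s within {0..T} = at s" if "a < s" "s < c" for s
    using that subac a c b t by (intro at_within_Icc_at) auto
  have "norm (P c) \<le> L * norm (P c) * (c - a)"
  proof (cases "0 < trace (P c)")
    case True
    have pos: "0 < trace (P s)" if s: "a < s" "s \<le> c" for s
    proof (rule ccontr)
      assume neg: "\<not> ?thesis"
      have "\<exists>x\<ge>s. x \<le> c \<and> trace (P x) = 0"
        using neg True s
        by (intro IVT' continuous_on_subset[OF trc]) auto
      then show False using tnz s by force
    qed
    show ?thesis
      unfolding L_def
    proof (rule norm_le_from_zero[OF \<open>a < c\<close> continuous_on_subset[OF Pc subac] a(3)])
      fix s assume s: "a < s" "s < c"
      then have sT: "s \<in> {0..T}" using subac by auto
      show "(P has_vector_derivative field (P s)) (at s)"
        using P(2)[OF sT] at[OF s] by simp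
      show "transpose (P s) = P s" by (rule P(3)[OF sT])
      show "norm (P s) \<le> norm (P c)" using max s c by auto
    qed (use pos K Kt in auto)
  next
    case False
    then have neg0: "trace (P c) < 0" using tnz[of c] \<open>a < c\<close> by simp
    have neg: "trace (P s) < 0" if s: "a < s" "s \<le> c" for s
    proof (rule ccontr)
      assume "\<not> ?thesis"
      then have "\<exists>x\<ge>s. x \<le> c \<and> trace (P x) = 0"
        using neg0 s
        by (intro IVT2' continuous_on_subset[OF trc]) auto
      then show False using tnz s by force
    qed
    have trm: "trace (- X) = - trace X" for X :: "real^'n^'n" by (simp add: trace_def sum_negf)
    \<comment> \<open>The reflected curve has positive trace and, by \<open>field_minus\<close>,
      solves the same equation.\<close>
    have "norm (- P c) \<le> (K + K * Kt) * norm (P c) * (c - a)"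
    proof (rule norm_le_from_zero[OF \<open>a < c\<close>, of "\<lambda>s. - P s"])
      show "continuous_on {a..c} (\<lambda>s. - P s)"
        by (intro continuous_intros continuous_on_subset[OF Pc subac])
      fix s assume s: "a < s" "s < c"
      then have sT: "s \<in> {0..T}" using subac by auto
      show "((\<lambda>s. - P s) has_vector_derivative field (- P s)) (at s)"
        using P(2)[OF sT] at[OF s] by (simp add: field_minus has_vector_derivative_minus)
      show "transpose (- P s) = - P s"
        using P(3)[OF sT] by (simp add: transpose_def vec_eq_iff)
      show "norm (- P s) \<le> norm (P c)" using max s c by auto
    qed (use neg K Kt a in \<open>auto simp: trm\<close>)
    then show ?thesis by (simp add: L_def)
  qed
  also have "L * norm (P c) * (c - a) \<le> L * norm (P c) * (1 / (2 * (L + 1)))"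
    using b c L by (intro mult_left_mono) auto
  also have "\<dots> = (L / (2 * (L + 1))) * norm (P c)" by simp
  also have "\<dots> < 1 * norm (P c)"
    using L \<open>0 < norm (P c)\<close> by (intro mult_strict_right_mono) (auto simp: field_simps)
  finally show False by simp
qed

end

section \<open>Strict positivity\<close>

theorem lemma4:
  fixes A :: "real^'n^'n" and B :: "real^'p^'n" and C :: "real^'n^'m"
    and R :: "real^'p^'p" and \<alpha> :: real
  assumes "R \<in> pd_matrices"
    and "\<alpha> > 0"
    and "observable A C"
  shows "strictly_positive_system (riccati_rhs A B C R \<alpha>) riccati_domain"
proof -
  interpret riccati A "B ** matrix_inv R ** transpose B" C \<alpha>
    by unfold_locales (rule psd_congruence_inverse[OF assms(1)], rule assms(2))
  have rhs: "riccati_rhs A B C R \<alpha> = field"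
  proof
    fix P
    show "riccati_rhs A B C R \<alpha> P = field P"
      by (cases "P = 0")
         (simp_all add: riccati_rhs_def field_0, simp add: field_def lin_def matrix_mul_assoc)
  qed
  have zero_psd: "0 \<in> psd_cone"
    by (simp add: psd_cone_def symmetric_matrices_def transpose_def vec_eq_iff)
  have domain_psd: "X \<in> psd_cone \<and> 0 < trace X \<Longrightarrow> X \<in> riccati_domain" "0 \<in> riccati_domain" for X
    using zero_psd by (auto simp: riccati_domain_def psd_cone_def)
  show ?thesis
    unfolding strictly_positive_system_def rhs
  proof (intro allI impI)
    fix t :: real assume t: "t > 0"
    \<comment> \<open>The expected solutions: constant from \<open>0\<close>, otherwise inside the
      cone with positive trace. \<open>flow_sol\<close> shows that every competitor in
      \<open>riccati_domain\<close> ends at the same point.\<close>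
    define sol where "sol = (\<lambda>P0 P. P 0 = P0 \<and>
      (\<forall>s\<in>{0..t}. (P has_vector_derivative field (P s)) (at s within {0..t}) \<and>
        (if P0 = 0 then P s = 0 else P s \<in> psd_cone \<and> 0 < trace (P s))))"
    have ex: "\<exists>P. sol P0 P" if P0: "P0 \<in> psd_cone" for P0
    proof (cases "P0 = 0")
      case True
      then show ?thesis by (intro exI[of _ "\<lambda>s. 0"]) (simp add: sol_def field_0)
    next
      case False
      obtain P where "P 0 = P0"
        "\<And>s. s \<in> {0..t} \<Longrightarrow> (P has_vector_derivative field (P s)) (at s within {0..t})"
        "\<And>s. s \<in> {0..t} \<Longrightarrow> P s \<in> psd_cone" "\<And>s. s \<in> {0..t} \<Longrightarrow> 0 < trace (P s)"
        using solution_exists[OF P0 False, of t] t by auto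
      then show ?thesis using False by (auto simp: sol_def)
    qed
    have flow_sol: "flow_value field riccati_domain t P0 X \<longleftrightarrow> X = P t"
      if P0: "P0 \<in> psd_cone" and P: "sol P0 P" for P0 P X
    proof
      assume "X = P t"
      moreover have "P s \<in> riccati_domain" if "s \<in> {0..t}" for s
        using P that domain_psd(1)[of "P s"] domain_psd(2)
        by (cases "P0 = 0") (auto simp: sol_def)
      then have "solves_ivp field riccati_domain P0 t P"
        using P by (auto simp: solves_ivp_def sol_def)
      ultimately show "flow_value field riccati_domain t P0 X"
        by (auto simp: flow_value_def)
    next
      assume "flow_value field riccati_domain t P0 X"
      then obtain Q where Q: "Q 0 = P0" "Q t = X"
        "\<And>s. s \<in> {0..t} \<Longrightarrow> (Q has_vector_derivative field (Q s)) (at s within {0..t})"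
        "\<And>s. s \<in> {0..t} \<Longrightarrow> Q s \<in> riccati_domain"
        by (auto simp: flow_value_def solves_ivp_def)
      have tt: "t \<in> {0..t}" using t by simp
      have sQ: "transpose (Q s) = Q s" "Q s = 0 \<or> trace (Q s) \<noteq> 0" if "s \<in> {0..t}" for s
        using Q(4)[OF that] by (auto simp: riccati_domain_def symmetric_matrices_def)
      show "X = P t"
      proof (cases "P0 = 0")
        case True
        then show ?thesis
          using solution_from_zero[OF _ Q(3) sQ tt] Q(1,2) P tt by (simp add: sol_def)
      next
        case False
        then have "P 0 = P0"
          "\<And>s. s \<in> {0..t} \<Longrightarrow> (P has_vector_derivative field (P s)) (at s within {0..t})"
          "\<And>s. s \<in> {0..t} \<Longrightarrow> transpose (P s) = P s"
          using P by (auto simp: sol_def intro: psd_coneD(1))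
        from solution_unique[OF P0 False Q(1,3) sQ(1) this tt] show ?thesis
          using Q(2) by simp
      qed
    qed
    have flow_eq: "flow field riccati_domain t P0 = P t" if "P0 \<in> psd_cone" "sol P0 P" for P0 P
      using flow_sol[OF that] by (simp add: flow_def)
    have flow_psd: "flow field riccati_domain t P0 \<in> psd_cone" if P0: "P0 \<in> psd_cone" for P0
    proof -
      obtain P where P: "sol P0 P" using ex[OF P0] by blast
      then have "P t \<in> psd_cone" using t zero_psd by (cases "P0 = 0") (auto simp: sol_def)
      then show ?thesis using flow_eq[OF P0 P] by simp
    qed
    have strict: "flow field riccati_domain t Y - flow field riccati_domain t X \<in> pd_matrices"
      if X: "loewner_le 0 X" and XY: "loewner_le X Y" and "X \<noteq> Y" for X Y
    proof -
      have pX: "X \<in> psd_cone" and pD: "Y - X \<in> psd_cone"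
        using X XY by (auto simp: loewner_le_def)
      have pY: "Y \<in> psd_cone"
      proof -
        have "0 \<le> x \<bullet> (Y *v x)" for x
          using psd_coneD(2)[OF pX, of x] psd_coneD(2)[OF pD, of x]
          by (simp add: matrix_vector_mult_diff_rdistrib inner_diff_right)
        moreover have "transpose Y = Y"
          using psd_coneD(1)[OF pX] psd_coneD(1)[OF pD] by (simp add: transpose_diff)
        ultimately show ?thesis by (simp add: psd_cone_def symmetric_matrices_def)
      qed
      have "Y \<noteq> 0"
      proof
        assume "Y = 0"
        then have "trace X \<le> 0" using psd_trace_nonneg[OF pD] trace_sub[of Y X]
          by (simp add: trace_def)
        then show False using psd_trace_pos[OF pX] \<open>X \<noteq> Y\<close> \<open>Y = 0\<close> by force
      qed
      \<comment> \<open>Since \<open>Y\<close> is nonzero, \<open>Q\<close> has positive trace and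
        can serve as the point of linearization; \<open>X\<close> may be \<open>0\<close>, and then
        \<open>P\<close> is the zero solution.\<close>
      obtain P Q where P: "sol X P" and Q: "sol Y Q" using ex pX pY by blast
      have "Q t - P t \<in> pd_matrices"
      proof (rule difference_pd[OF assms(3) t])
        show "Q 0 - P 0 \<in> psd_cone" "Q 0 \<noteq> P 0"
          using P Q pD \<open>X \<noteq> Y\<close> by (auto simp: sol_def)
        fix s assume "s \<in> {0..t}"
        then show "(Q has_vector_derivative field (Q s)) (at s within {0..t})"
          "(P has_vector_derivative field (P s)) (at s within {0..t})"
          "Q s \<in> psd_cone \<and> 0 < trace (Q s)"
          "P s = 0 \<or> P s \<in> psd_cone \<and> 0 < trace (P s)"
          using P Q \<open>Y \<noteq> 0\<close> by (cases "X = 0"; auto simp: sol_def)+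
      qed
      then show ?thesis using flow_eq[OF pX P] flow_eq[OF pY Q] by simp
    qed
    have "\<exists>!X. flow_value field riccati_domain t P0 X" if "P0 \<in> psd_cone" for P0
      using ex[OF that] flow_sol[OF that] by auto
    then show "(\<forall>P0\<in>psd_cone. \<exists>!X. flow_value field riccati_domain t P0 X) \<and>
        flow field riccati_domain t ` psd_cone \<subseteq> psd_cone \<and>
        strictly_order_preserving (flow field riccati_domain t)"
      using flow_psd strict by (auto simp: strictly_order_preserving_def)
  qed
qed

end
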